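(* Let $s,p\geq 1$ be integers. (1) The family $\mathcal{H}^{(p,s)}(2p+s)$ is EKR but not strongly EKR. (2) If $s=1$ and $n>2p+1$ is an integer, then $\mathcal{H}^{(p,s)}(n)$ (that is, $\mathcal{H}^{(p,1)}(n)$) is strongly EKR.
   Context: For a finite set $X$, a family $\mathcal{G}\subseteq 2^X$ and $x\in X$, let $\mathcal{G}_x=\{G\in\mathcal{G}: x\in G\}$; it is called the star in $\mathcal{G}$ centered at $x$. A family $\mathcal{F}$ of sets is intersecting if $F\cap G\neq\emptyset$ for all $F,G\in\mathcal{F}$. A family $\mathcal{G}\subseteq 2^X$ is EKR if there exists $x\in X$ such that $|\mathcal{F}|\leq|\mathcal{G}_x|$ for every intersecting subfamily $\mathcal{F}\subseteq\mathcal{G}$. It is strongly EKR if every maximum-size intersecting subfamily of $\mathcal{G}$ is a star in $\mathcal{G}$. The perfect matching graph $M_n$ is the graph consisting of $n$ pairwise disjoint edges $e_1,\ldots,e_n$, with $e_i=\{l_i,r_i\}$; its vertex set is $V(M_n)=\{l_1,\ldots,l_n\}\cup\{r_1,\ldots,r_n\}$ ($2n$ vertices). For $p,s\ge 0$ with $2p+s\geq 1$, $\mathcal{H}^{(p,s)}(n)\subseteq 2^{V(M_n)}$ is the family of vertex sets of all induced subgraphs of $M_n$ consisting of exactly $p$ disjoint edges and $s$ isolated vertices. Equivalently, it consists of all $(2p+s)$-element sets $H\subseteq V(M_n)$ that contain both endpoints of exactly $p$ of the edges $e_1,\dots,e_n$, exactly one endpoint of exactly $s$ of the edges, and no endpoint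 of the remaining $n-p-s$ edges. Here the ground set is $X=V(M_n)$. *)

theory Defs
  imports Main
begin

definition intersecting :: "'a set set \<Rightarrow> bool" where
  "intersecting \<F> \<longleftrightarrow> (\<forall>F\<in>\<F>. \<forall>G\<in>\<F>. F \<inter> G \<noteq> {})"

definition star :: "'a set set \<Rightarrow> 'a \<Rightarrow> 'a set set" where
  "star \<G> x = {G \<in> \<G>. x \<in> G}"

text \<open>The notions \<open>EKR\<close> and \<open>strongly_EKR\<close> are meant for a finite ground set \<open>X\<close>
  and a family \<open>\<G> \<subseteq> Pow X\<close>, so that every cardinality below is that of a finite set.\<close>

definition EKR :: "'a set \<Rightarrow> 'a set set \<Rightarrow> bool" where
  "EKR X \<G> \<longleftrightarrow>
     (\<exists>x\<in>X. \<forall>\<F>. \<F> \<subseteq> \<G> \<and> intersecting \<F> \<longrightarrow> card \<F> \<le> card (star \<G> x))"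

definition maximum_intersecting :: "'a set set \<Rightarrow> 'a set set \<Rightarrow> bool" where
  "maximum_intersecting \<G> \<F> \<longleftrightarrow> \<F> \<subseteq> \<G> \<and> intersecting \<F> \<and>
     (\<forall>\<F>'. \<F>' \<subseteq> \<G> \<and> intersecting \<F>' \<longrightarrow> card \<F>' \<le> card \<F>)"

definition strongly_EKR :: "'a set \<Rightarrow> 'a set set \<Rightarrow> bool" where
  "strongly_EKR X \<G> \<longleftrightarrow>
     (\<forall>\<F>. maximum_intersecting \<G> \<F> \<longrightarrow> (\<exists>x\<in>X. \<F> = star \<G> x))"

datatype vertex = L nat | R nat

definition M_verts :: "nat \<Rightarrow> vertex set" where
  "M_verts n = L ` {1..n} \<union> R ` {1..n}"

definition M_edges :: "nat \<Rightarrow> vertex set set" where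
  "M_edges n = (\<lambda>i. {L i, R i}) ` {1..n}"

definition induced_edges :: "'a set set \<Rightarrow> 'a set \<Rightarrow> 'a set set" where
  "induced_edges E H = {e \<in> E. e \<subseteq> H}"

definition isolated_verts :: "'a set set \<Rightarrow> 'a set \<Rightarrow> 'a set" where
  "isolated_verts E H = {v \<in> H. \<forall>e\<in>induced_edges E H. v \<notin> e}"

text \<open>The edges of \<open>M\<^sub>n\<close> are pairwise disjoint, so an induced subgraph always consists of
  disjoint edges and isolated vertices; only their numbers have to be prescribed.\<close>

definition matching_family :: "nat \<Rightarrow> nat \<Rightarrow> nat \<Rightarrow> vertex set set" where
  "matching_family p s n = {H. H \<subseteq> M_verts n \<and>
     card (induced_edges (M_edges n) H) = p \<and> card (isolated_verts (M_edges n) H) = s}"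

lemma finite_M_verts: "finite (M_verts n)"
  by (simp add: M_verts_def)

lemma card_M_verts: "card (M_verts n) = 2 * n"
proof -
  have "card (L ` {1..n}) = n" "card (R ` {1..n}) = n"
    by (simp_all add: card_image inj_on_def)
  then show ?thesis
    unfolding M_verts_def by (subst card_Un_disjoint) auto
qed

lemma matching_family_subset_Pow: "matching_family p s n \<subseteq> Pow (M_verts n)"
  by (auto simp: matching_family_def)

lemma matching_family_iff:
  "H \<in> matching_family p s n \<longleftrightarrow> H \<subseteq> M_verts n \<and> card H = 2 * p + s \<and>
     card {e \<in> M_edges n. card (e \<inter> H) = 2} = p \<and>
     card {e \<in> M_edges n. card (e \<inter> H) = 1} = s \<and>
     card {e \<in> M_edges n. card (e \<inter> H) = 0} = n - p - s" (is "_ \<longleftrightarrow> ?rhs")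
proof (cases "H \<subseteq> M_verts n")
  case True
  define A where "A = (\<lambda>k. {e \<in> M_edges n. card (e \<inter> H) = k})"
  let ?I = "isolated_verts (M_edges n) H"
  have finE: "finite (M_edges n)" by (simp add: M_edges_def)
  then have finA: "finite (A k)" for k by (simp add: A_def)
  have cardE: "card (M_edges n) = n"
    unfolding M_edges_def by (subst card_image) (auto simp: inj_on_def doubleton_eq_iff)
  have finH: "finite H" using True finite_M_verts finite_subset by blast
  have e2: "card e = 2" "finite e" if "e \<in> M_edges n" for e
    using that by (auto simp: M_edges_def)
  have le2: "card (e \<inter> H) \<le> 2" if "e \<in> M_edges n" for e
    using e2[OF that] card_mono[of e "e \<inter> H"] by simp
  have ind: "induced_edges (M_edges n) H = A 2"
  proof -
    have "e \<subseteq> H \<longleftrightarrow> card (e \<inter> H) = 2" if "e \<in> M_edges n" for e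
      using e2[OF that] card_subset_eq[of e "e \<inter> H"]
      by (metis Int_absorb2 Int_lower1 inf.orderI)
    then show ?thesis by (auto simp: induced_edges_def A_def)
  qed
  have disj: "e \<inter> f = {}" if "e \<in> M_edges n" "f \<in> M_edges n" "e \<noteq> f" for e f
    using that by (auto simp: M_edges_def)
  have cover: "\<exists>e\<in>M_edges n. v \<in> e" if "v \<in> H" for v
    using that True by (fastforce simp: M_edges_def M_verts_def)
  have card_UN: "card (\<Union>e\<in>B. e \<inter> H) = (\<Sum>e\<in>B. card (e \<inter> H))" if "B \<subseteq> M_edges n" for B
    using that finE finite_subset disj finH
    by (intro card_UN_disjoint) (fastforce)+
  have parts: "M_edges n = A 0 \<union> A 1 \<union> A 2"
    using le2 by (fastforce simp: A_def le_Suc_eq numeral_2_eq_2)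
  have n: "n = card (A 0) + card (A 1) + card (A 2)"
  proof -
    have "card (A 0 \<union> A 1 \<union> A 2) = card (A 0 \<union> A 1) + card (A 2)"
      by (rule card_Un_disjoint) (auto simp: finA, auto simp: A_def)
    moreover have "card (A 0 \<union> A 1) = card (A 0) + card (A 1)"
      by (rule card_Un_disjoint) (auto simp: finA, auto simp: A_def)
    ultimately show ?thesis using cardE parts by simp
  qed
  have I: "?I = (\<Union>e\<in>A 1. e \<inter> H)"
  proof (intro equalityI subsetI)
    fix v assume v: "v \<in> ?I"
    then have vH: "v \<in> H" by (simp add: isolated_verts_def)
    obtain e where e: "e \<in> M_edges n" "v \<in> e" using cover[OF vH] by blast
    have "e \<notin> A 2" using v e by (auto simp: isolated_verts_def ind)
    moreover have "e \<notin> A 0" using vH e finH by (auto simp: A_def)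
    ultimately show "v \<in> (\<Union>e\<in>A 1. e \<inter> H)" using e vH parts by blast
  next
    fix v assume "v \<in> (\<Union>e\<in>A 1. e \<inter> H)"
    then obtain e where e: "e \<in> A 1" "v \<in> e" "v \<in> H" by blast
    have "v \<notin> f" if f: "f \<in> A 2" for f
    proof
      assume "v \<in> f"
      then have "e = f" using disj[of e f] e f by (auto simp: A_def)
      then show False using e f by (simp add: A_def)
    qed
    then show "v \<in> ?I" using e by (simp add: isolated_verts_def ind)
  qed
  have cI: "card ?I = card (A 1)"
    unfolding I by (subst card_UN) (auto simp: A_def)
  have cH: "card H = 2 * card (A 2) + card (A 1)"
  proof -
    have "H = ?I \<union> (\<Union>e\<in>A 2. e \<inter> H)"
      by (auto simp: isolated_verts_def ind)
    moreover have "?I \<inter> (\<Union>e\<in>A 2. e \<inter> H) = {}"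
      by (auto simp: isolated_verts_def ind)
    moreover have "card (\<Union>e\<in>A 2. e \<inter> H) = 2 * card (A 2)"
      by (subst card_UN) (auto simp: A_def)
    ultimately show ?thesis
      using cI finH by (metis card_Un_disjoint finite_Un add.commute)
  qed
  have "H \<in> matching_family p s n \<longleftrightarrow> card (A 2) = p \<and> card (A 1) = s"
    using True by (simp add: matching_family_def ind cI)
  also have "\<dots> \<longleftrightarrow> ?rhs"
    using True cH n unfolding A_def by auto
  finally show ?thesis .
qed (simp add: matching_family_def)

end

theory Submission
  imports Defs
begin

text \<open>For \<open>n = 2 p + s\<close> every member has \<open>n\<close> of the \<open>2 n\<close> vertices, so two members are disjoint iff
  they are complementary: an intersecting family contains at most one set of every complementary
  pair, and any choice of one set per pair is optimal.  Stars are such choices, but not the only ones.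

  For \<open>s = 1\<close> use Katona's cycle method.  Place the \<open>2 n\<close> vertices on a cycle in which the two
  endpoints of every edge are neighbours.  All \<open>2 n\<close> arcs of odd length \<open>2 p + 1\<close> belong to the
  family, and since \<open>2 (2 p + 1) < 2 n\<close> at most \<open>2 p + 1\<close> of them can lie in an intersecting family,
  with equality only for the arcs through one common vertex, the centre.  Averaging over all such
  cycles, equality holds on every cycle if the family is maximum.  Finally the centre is the same
  vertex \<open>x\<close> on sufficiently many cycles: the arcs containing \<open>x\<close> are determined by a set \<open>P\<close> of \<open>p\<close>
  edges on one side, a set \<open>Q\<close> of \<open>p - 1\<close> edges on the other and one more vertex, and these can be
  exchanged step by step without moving the centre, until the whole star at \<open>x\<close> is reached.\<close>

section \<open>Matching families\<close>

primrec idx :: "vertex \<Rightarrow> nat" where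
  "idx (L i) = i" | "idx (R i) = i"

primrec mate :: "vertex \<Rightarrow> vertex" where
  "mate (L i) = R i" | "mate (R i) = L i"

lemma mate_mate [simp]: "mate (mate v) = v"
  by (cases v) auto

lemma idx_mate [simp]: "idx (mate v) = idx v"
  by (cases v) auto

lemma mate_neq [simp]: "mate v \<noteq> v" "v \<noteq> mate v"
  by (cases v; simp)+

lemma idx_eq_iff: "idx v = idx w \<longleftrightarrow> v = w \<or> v = mate w"
  by (cases v; cases w) auto

lemma mem_M_verts_iff [simp]: "v \<in> M_verts n \<longleftrightarrow> idx v \<in> {1..n}"
  by (cases v) (auto simp: M_verts_def)

text \<open>Counting by edge index avoids sets of edges. A vertex of \<open>H\<close> is isolated
  iff its mate is absent, and \<open>idx\<close> is injective on these vertices.\<close>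

lemma matching_family_altdef:
  "H \<in> matching_family p s n \<longleftrightarrow> H \<subseteq> M_verts n \<and>
     card {i. L i \<in> H \<and> R i \<in> H} = p \<and> card {i. (L i \<in> H) \<noteq> (R i \<in> H)} = s"
proof (cases "H \<subseteq> M_verts n")
  case True
  have "induced_edges (M_edges n) H = (\<lambda>i. {L i, R i}) ` {i. L i \<in> H \<and> R i \<in> H}"
    using True by (fastforce simp: induced_edges_def M_edges_def)
  then have 1: "card (induced_edges (M_edges n) H) = card {i. L i \<in> H \<and> R i \<in> H}"
    by (simp add: card_image inj_on_def doubleton_eq_iff)
  have iso: "isolated_verts (M_edges n) H = {v \<in> H. mate v \<notin> H}"
  proof (intro equalityI subsetI CollectI conjI)
    fix v assume v: "v \<in> isolated_verts (M_edges n) H"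
    then show vH: "v \<in> H" by (simp add: isolated_verts_def)
    have "{v, mate v} = {L (idx v), R (idx v)}" by (cases v) auto
    then have e: "{v, mate v} \<in> M_edges n"
      using vH True by (auto simp: M_edges_def)
    show "mate v \<notin> H"
      using v vH e by (auto simp: isolated_verts_def induced_edges_def)
  next
    fix v assume "v \<in> {v \<in> H. mate v \<notin> H}"
    then show "v \<in> isolated_verts (M_edges n) H"
      by (auto simp: isolated_verts_def induced_edges_def M_edges_def)
  qed
  have "inj_on idx {v \<in> H. mate v \<notin> H}"
    by (auto simp: inj_on_def idx_eq_iff)
  moreover have "idx ` {v \<in> H. mate v \<notin> H} = {i. (L i \<in> H) \<noteq> (R i \<in> H)}"
  proof (intro equalityI subsetI)
    fix i assume "i \<in> idx ` {v \<in> H. mate v \<notin> H}"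
    then obtain v where "v \<in> H" "mate v \<notin> H" "i = idx v" by auto
    then show "i \<in> {i. (L i \<in> H) \<noteq> (R i \<in> H)}" by (cases v) auto
  next
    fix i assume "i \<in> {i. (L i \<in> H) \<noteq> (R i \<in> H)}"
    then have "L i \<in> {v \<in> H. mate v \<notin> H} \<or> R i \<in> {v \<in> H. mate v \<notin> H}" by auto
    then show "i \<in> idx ` {v \<in> H. mate v \<notin> H}" by force
  qed
  ultimately have "card (isolated_verts (M_edges n) H) = card {i. (L i \<in> H) \<noteq> (R i \<in> H)}"
    unfolding iso using card_image[of idx "{v \<in> H. mate v \<notin> H}"] by simp
  then show ?thesis using 1 True by (simp add: matching_family_def)
qed (simp add: matching_family_def)

text \<open>Normal form for \<open>s = 1\<close>: the edges of \<open>P\<close> taken whole and one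
  endpoint \<open>v\<close> of a further edge. The arcs of a cycle are later brought into exactly
  this form.\<close>

lemma matching_family_1_iff:
  "H \<in> matching_family p 1 n \<longleftrightarrow>
     (\<exists>P v. P \<subseteq> {1..n} \<and> card P = p \<and> idx v \<in> {1..n} - P \<and> H = insert v (idx -` P))"
proof
  assume "H \<in> matching_family p 1 n"
  then have H: "H \<subseteq> M_verts n" "card {i. L i \<in> H \<and> R i \<in> H} = p"
    and "card {i. (L i \<in> H) \<noteq> (R i \<in> H)} = 1"
    unfolding matching_family_altdef by auto
  then obtain k where k: "{i. (L i \<in> H) \<noteq> (R i \<in> H)} = {k}"
    by (auto simp: card_1_singleton_iff)
  define v where "v = (if L k \<in> H then L k else R k)"
  have vH: "v \<in> H" "idx v = k" "mate v \<notin> H" using k unfolding v_def by auto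
  have "H = insert v (idx -` {i. L i \<in> H \<and> R i \<in> H})"
  proof (intro equalityI subsetI)
    fix w assume w: "w \<in> H"
    show "w \<in> insert v (idx -` {i. L i \<in> H \<and> R i \<in> H})"
    proof (cases "mate w \<in> H")
      case True
      then show ?thesis using w by (cases w) auto
    next
      case False
      then have "idx w \<in> {i. (L i \<in> H) \<noteq> (R i \<in> H)}" using w by (cases w) auto
      then have "idx w = idx v" using k vH by auto
      then show ?thesis using w vH by (auto simp: idx_eq_iff)
    qed
  next
    fix w assume "w \<in> insert v (idx -` {i. L i \<in> H \<and> R i \<in> H})"
    then show "w \<in> H" using vH by (cases w) auto
  qed
  moreover have "idx v \<in> {1..n} - {i. L i \<in> H \<and> R i \<in> H}"
    using vH k H(1) by auto
  moreover have "{i. L i \<in> H \<and> R i \<in> H} \<subseteq> {1..n}" using H(1) by auto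
  ultimately show "\<exists>P v. P \<subseteq> {1..n} \<and> card P = p \<and> idx v \<in> {1..n} - P \<and> H = insert v (idx -` P)"
    using H(2) by blast
next
  assume "\<exists>P v. P \<subseteq> {1..n} \<and> card P = p \<and> idx v \<in> {1..n} - P \<and> H = insert v (idx -` P)"
  then obtain P v where *: "P \<subseteq> {1..n}" "card P = p" "idx v \<in> {1..n} - P" "H = insert v (idx -` P)"
    by blast
  have "{i. L i \<in> H \<and> R i \<in> H} = P" "{i. (L i \<in> H) \<noteq> (R i \<in> H)} = {idx v}"
    using *(3,4) by (cases v; auto)+
  moreover have "H \<subseteq> M_verts n" using * by auto
  ultimately show "H \<in> matching_family p 1 n"
    using *(2) by (simp add: matching_family_altdef)
qed

lemma finite_matching_family: "finite (matching_family p s n)"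
  using matching_family_subset_Pow finite_M_verts by (metis finite_Pow_iff finite_subset)

lemma star_intersecting: "intersecting (star \<G> x)"
  by (auto simp: intersecting_def star_def)

section \<open>The complement-closed case\<close>

text \<open>An intersecting family never contains a set together with its complement, so
  \<open>\<F>\<close> and the family of its complements are disjoint parts of \<open>\<G>\<close> of
  equal size.\<close>

lemma card_intersecting_complement_closed:
  assumes "finite V" "\<G> \<subseteq> Pow V" "\<And>H. H \<in> \<G> \<Longrightarrow> V - H \<in> \<G>"
    and F: "\<F> \<subseteq> \<G>" "intersecting \<F>"
  shows "2 * card \<F> \<le> card \<G>"
proof -
  have fin: "finite \<G>" using assms(1,2) by (meson finite_Pow_iff finite_subset)
  have inj: "inj_on ((-) V) \<G>" using assms(2) by (auto simp: inj_on_def)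
  have "card (((-) V) ` \<F>) = card \<F>"
    using inj F(1) by (meson card_image inj_on_subset)
  moreover have "\<F> \<inter> ((-) V) ` \<F> = {}"
    using F(2) by (fastforce simp: intersecting_def)
  moreover have "finite \<F>" using F(1) fin finite_subset by blast
  ultimately have "card (\<F> \<union> ((-) V) ` \<F>) = 2 * card \<F>"
    by (simp add: card_Un_disjoint)
  moreover have "\<F> \<union> ((-) V) ` \<F> \<subseteq> \<G>" using F(1) assms(3) by auto
  ultimately show ?thesis using fin by (metis card_mono)
qed

text \<open>Complementation matches the members through \<open>x\<close> with those avoiding
  \<open>x\<close>, so every star attains the bound for intersecting families.\<close>

lemma card_star_complement_closed:
  assumes "finite V" "\<G> \<subseteq> Pow V" "\<And>H. H \<in> \<G> \<Longrightarrow> V - H \<in> \<G>" "x \<in> V"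
  shows "2 * card (star \<G> x) = card \<G>"
proof -
  have fin: "finite \<G>" using assms(1,2) by (meson finite_Pow_iff finite_subset)
  have inj: "inj_on ((-) V) (star \<G> x)" using assms(2) by (auto simp: inj_on_def star_def)
  have "((-) V) ` star \<G> x = \<G> - star \<G> x"
  proof (intro equalityI subsetI)
    fix H assume H: "H \<in> \<G> - star \<G> x"
    then have "H = V - (V - H)" using assms(2) by auto
    moreover have "V - H \<in> star \<G> x" using H assms by (auto simp: star_def)
    ultimately show "H \<in> ((-) V) ` star \<G> x" by blast
  qed (use assms in \<open>auto simp: star_def\<close>)
  then have "card (star \<G> x) = card (\<G> - star \<G> x)"
    using inj by (metis card_image)
  moreover have "star \<G> x \<subseteq> \<G>" by (auto simp: star_def)
  ultimately show ?thesis
    using fin by (metis card_Diff_subset card_mono finite_subset le_add_diff_inverse mult_2)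
qed

text \<open>Complementation exchanges the whole edges with the missed ones and keeps the half edges;
  with \<open>2 * p + s\<close> edges there are \<open>p\<close> of either kind.\<close>

lemma matching_family_complement:
  assumes "H \<in> matching_family p s (2 * p + s)"
  shows "M_verts (2 * p + s) - H \<in> matching_family p s (2 * p + s)"
proof -
  let ?n = "2 * p + s" and ?V = "M_verts (2 * p + s)"
  let ?A = "{i. L i \<in> H \<and> R i \<in> H}" and ?B = "{i. (L i \<in> H) \<noteq> (R i \<in> H)}"
  have H: "H \<subseteq> ?V" "card ?A = p" "card ?B = s"
    using assms unfolding matching_family_altdef by auto
  have sub: "?A \<subseteq> {1..?n}" "?B \<subseteq> {1..?n}" using H(1) by fastforce+
  then have fin: "finite ?A" "finite ?B" using finite_subset by blast+
  have "card (?A \<union> ?B) = p + s"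
    using H fin by (subst card_Un_disjoint) auto
  moreover have "{i. L i \<in> ?V - H \<and> R i \<in> ?V - H} = {1..?n} - (?A \<union> ?B)" by auto
  ultimately have "card {i. L i \<in> ?V - H \<and> R i \<in> ?V - H} = p"
    using sub fin by (simp add: card_Diff_subset)
  moreover have "{i. (L i \<in> ?V - H) \<noteq> (R i \<in> ?V - H)} = ?B" using H(1) by auto
  ultimately show ?thesis using H unfolding matching_family_altdef by auto
qed

text \<open>Every member contains exactly half of the vertices.\<close>

lemma matching_family_disjoint_iff:
  assumes "H \<in> matching_family p s (2 * p + s)" "H' \<in> matching_family p s (2 * p + s)"
  shows "H \<inter> H' = {} \<longleftrightarrow> H' = M_verts (2 * p + s) - H"
proof
  let ?V = "M_verts (2 * p + s)"
  have c: "card H = 2 * p + s" "card H' = 2 * p + s" and sub: "H \<subseteq> ?V" "H' \<subseteq> ?V"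
    using assms by (auto simp only: matching_family_iff)
  assume "H \<inter> H' = {}"
  then have "H' \<subseteq> ?V - H" using sub by auto
  moreover have "card (?V - H) = 2 * p + s"
    using c sub finite_M_verts by (metis card_Diff_subset card_M_verts finite_subset diff_add_inverse mult_2)
  ultimately show "H' = ?V - H"
    using c by (metis card_subset_eq finite_Diff finite_M_verts)
qed auto

text \<open>Supplies explicit members: \<open>P\<close> are the whole edges, \<open>S\<close> the
  half edges, and \<open>T\<close> tells on which of these the left endpoint is taken.\<close>

lemma matching_family_UnI:
  assumes "P \<subseteq> {1..n}" "S \<subseteq> {1..n}" "P \<inter> S = {}" "card P = p" "card S = s" "T \<subseteq> S"
  shows "L ` (P \<union> T) \<union> R ` (P \<union> (S - T)) \<in> matching_family p s n" (is "?H \<in> _")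
proof -
  have "{i. L i \<in> ?H \<and> R i \<in> ?H} = P" "{i. (L i \<in> ?H) \<noteq> (R i \<in> ?H)} = S"
    using assms by auto
  then show ?thesis using assms unfolding matching_family_altdef by auto
qed

lemma EKR_matching_family_minimal:
  assumes "s \<ge> 1"
  shows "EKR (M_verts (2 * p + s)) (matching_family p s (2 * p + s))"
proof -
  let ?V = "M_verts (2 * p + s)" and ?G = "matching_family p s (2 * p + s)"
  have x: "L 1 \<in> ?V" using assms by auto
  have "card \<F> \<le> card (star ?G (L 1))" if "\<F> \<subseteq> ?G" "intersecting \<F>" for \<F>
    using card_intersecting_complement_closed[OF finite_M_verts matching_family_subset_Pow
        matching_family_complement that]
      card_star_complement_closed[OF finite_M_verts matching_family_subset_Pow
        matching_family_complement x]
    by simp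
  then show ?thesis unfolding EKR_def using x by blast
qed

text \<open>In the star at \<open>L 1\<close>, one set \<open>A\<close> is replaced by its complement.  The result is still
  intersecting, and it is no star because \<open>L 1\<close> is the only vertex common to the remaining sets.\<close>

lemma not_strongly_EKR_matching_family_minimal:
  assumes s: "s \<ge> 1" and p: "p \<ge> 1"
  shows "\<not> strongly_EKR (M_verts (2 * p + s)) (matching_family p s (2 * p + s))"
proof
  let ?V = "M_verts (2 * p + s)" and ?G = "matching_family p s (2 * p + s)"
  let ?n = "2 * p + s"
  assume strong: "strongly_EKR ?V ?G"
  define H where "H = (\<lambda>P S T. L ` (P \<union> T) \<union> R ` (P \<union> (S - T)))"
  \<comment> \<open>\<open>A\<close> contains edge \<open>1\<close> whole, hence \<open>R 1\<close>,
    which the other three sets avoid. \<open>B1\<close> and \<open>B2\<close> share only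
    \<open>L 1\<close>, ..., \<open>L s\<close>; \<open>B3\<close> takes right endpoints on the
    edges \<open>2\<close>, ..., \<open>s\<close>, which leaves \<open>L 1\<close> alone.\<close>
  define A where "A = H {1..p} {p+1..p+s} {p+1..p+s}"
  define B1 where "B1 = H {s+1..s+p} {1..s} {1..s}"
  define B2 where "B2 = H {s+p+1..?n} {1..s} {1..s}"
  define B3 where "B3 = H {s+1..s+p} {1..s} {1}"
  note defs = A_def B1_def B2_def B3_def
  have mem: "A \<in> ?G" "B1 \<in> ?G" "B2 \<in> ?G" "B3 \<in> ?G"
    unfolding defs H_def using s p by (intro matching_family_UnI; auto)+
  have L1: "L 1 \<in> A" "L 1 \<in> B1" "L 1 \<in> B2" "L 1 \<in> B3"
    unfolding defs H_def using s p by auto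
  have neq: "B1 \<noteq> A" "B2 \<noteq> A" "B3 \<noteq> A"
  proof -
    have "R 1 \<in> A" "R 1 \<notin> B1" "R 1 \<notin> B2" "R 1 \<notin> B3"
      unfolding defs H_def using s p by auto
    then show "B1 \<noteq> A" "B2 \<noteq> A" "B3 \<noteq> A" by auto
  qed
  have common: "y = L 1" if "y \<in> B1" "y \<in> B2" "y \<in> B3" for y
    using that unfolding defs H_def by auto
  define F where "F = insert (?V - A) (star ?G (L 1) - {A})"
  have FG: "F \<subseteq> ?G"
    using matching_family_complement[OF mem(1)] by (auto simp: F_def star_def)
  have intF: "intersecting F"
    unfolding intersecting_def
  proof (intro ballI notI)
    fix X Y assume XY: "X \<in> F" "Y \<in> F" "X \<inter> Y = {}"
    then have "Y = ?V - X" using matching_family_disjoint_iff FG by blast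
    moreover have "A \<subseteq> ?V" "X \<subseteq> ?V" using mem(1) FG XY(1) matching_family_subset_Pow by blast+
    \<comment> \<open>Of two complementary members exactly one contains \<open>L 1\<close>, so the
      other is \<open>?V - A\<close>; its partner would be \<open>A\<close>, which was
      removed.\<close>
    ultimately show False
      using XY L1(1) unfolding F_def star_def by auto
  qed
  have fin: "finite (star ?G (L 1))"
    using finite_matching_family by (simp add: star_def)
  have "card F = card (star ?G (L 1))"
  proof -
    have "?V - A \<notin> star ?G (L 1) - {A}" using L1 by (auto simp: star_def)
    moreover have "A \<in> star ?G (L 1)" using mem L1 by (simp add: star_def)
    ultimately show ?thesis using fin unfolding F_def
      by (metis card.remove card_insert_disjoint finite_Diff)
  qed
  moreover have "2 * card (star ?G (L 1)) = card ?G"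
    using s by (intro card_star_complement_closed[OF finite_M_verts matching_family_subset_Pow
        matching_family_complement]) auto
  ultimately have cardF: "2 * card F = card ?G" by simp
  have "card \<F>' \<le> card F" if "\<F>' \<subseteq> ?G" "intersecting \<F>'" for \<F>'
    using card_intersecting_complement_closed[OF finite_M_verts matching_family_subset_Pow
        matching_family_complement that] cardF by linarith
  with FG intF have "maximum_intersecting ?G F"
    unfolding maximum_intersecting_def by (intro conjI allI impI) simp_all
  then obtain y where y: "F = star ?G y" using strong unfolding strongly_EKR_def by blast
  have "B1 \<in> F" "B2 \<in> F" "B3 \<in> F" using mem L1 neq by (auto simp: F_def star_def)
  then have "y = L 1" using common y by (auto simp: star_def)
  moreover have "?V - A \<in> F" by (simp add: F_def)
  ultimately show False using y L1 by (auto simp: star_def)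
qed

section \<open>Intersecting arcs on a cycle\<close>

lemma mod_range_bij:
  fixes N a :: int
  assumes "N > 0"
  shows "bij_betw (\<lambda>j. (j - a) mod N) {0..<N} {0..<N}"
  by (rule bij_betw_byWitness[where f' = "\<lambda>j. (j + a) mod N"])
    (use assms in \<open>auto simp: mod_simps\<close>)

lemma periodic_shift:
  fixes Q :: "int \<Rightarrow> bool" and N :: int
  assumes "\<And>i. Q (i + N) = Q i"
  shows "Q (i + k * N) = Q i"
proof (induction k rule: int_induct[where k = 0])
  case (step1 k)
  then show ?case using assms[of "i + k * N"] by (simp add: algebra_simps)
next
  case (step2 k)
  then show ?case using assms[of "i + (k - 1) * N"] by (simp add: algebra_simps)
qed simp

text \<open>\<open>Q j\<close> stands for membership of the arc of length \<open>K\<close> starting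
  at \<open>j\<close>. Relative to one member \<open>a\<close>, the other possible starts form pairs
  \<open>t\<close>, \<open>t + (N - K)\<close> with \<open>0 < t < K\<close> that exclude each
  other; this gives the bound. In the equality case one of each pair is present, and the strict
  \<open>2 * K < N\<close> makes the starts consecutive; the last one, \<open>y\<close>, is a
  position common to all \<open>K\<close> arcs.\<close>

lemma
  fixes Q :: "int \<Rightarrow> bool" and K N :: int
  assumes per: "\<And>i. Q (i + N) = Q i"
    and K: "1 \<le> K" "2 * K < N"
    and Q: "\<And>i j. Q i \<Longrightarrow> Q j \<Longrightarrow> K \<le> j - i \<Longrightarrow> j - i \<le> N - K \<Longrightarrow> False"
  shows card_cyclic_intersecting: "int (card {j \<in> {0..<N}. Q j}) \<le> K"
    and cyclic_intersecting_block: "int (card {j \<in> {0..<N}. Q j}) = K \<Longrightarrow>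
          \<exists>y\<in>{0..<N}. \<forall>d\<in>{0..<N}. Q (y - d) \<longleftrightarrow> d < K"
proof -
  let ?S = "{j \<in> {0..<N}. Q j}"
  have "int (card ?S) \<le> K \<and> (int (card ?S) = K \<longrightarrow> (\<exists>y\<in>{0..<N}. \<forall>d\<in>{0..<N}. Q (y - d) \<longleftrightarrow> d < K))"
  proof (cases "?S = {}")
    case True
    then show ?thesis using K by (simp only: True card.empty) simp
  next
    case False
    then obtain a where a: "Q a" by auto
    have perk: "Q (i + k * N) = Q i" for i k using periodic_shift[of Q N] per by blast
    define T where "T = {t \<in> {0..<N}. Q (a + t)}"
    have "bij_betw (\<lambda>j. (j - a) mod N) ?S T"
    proof -
      have "Q (a + (j - a) mod N) = Q j" for j
      proof -
        have "a + (j - a) mod N + (j - a) div N * N = j"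
          using div_mult_mod_eq[of "j - a" N] by linarith
        then show ?thesis using perk by metis
      qed
      then have "(\<lambda>j. (j - a) mod N) ` ?S = (\<lambda>j. (j - a) mod N) ` {0..<N} \<inter> {t. Q (a + t)}"
        by blast
      also have "\<dots> = T"
        using mod_range_bij[of N a] K by (auto simp: bij_betw_def T_def)
      finally show ?thesis
        using mod_range_bij[of N a] K by (auto intro: bij_betw_subset)
    qed
    then have cardT: "card ?S = card T" by (rule bij_betw_same_card)
    have T: "t < K \<or> N - K < t" if "t \<in> T" for t
      using that Q[OF a, of "a + t"] by (force simp: T_def)
    \<comment> \<open>\<open>g\<close> identifies the two offsets of a pair; by \<open>clash\<close>
      it is injective on \<open>T\<close>.\<close>
    define g where "g = (\<lambda>t. if t < K then t else t - (N - K))"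
    have gim: "g ` T \<subseteq> {0..<K}"
      using T by (force simp: g_def T_def)
    have clash: "\<not> (t \<in> T \<and> t' \<in> T)" if "K \<le> t' - t" "t' - t \<le> N - K" for t t'
      using Q[of "a + t" "a + t'"] that by (auto simp: T_def)
    have ginj: "inj_on g T"
    proof (rule inj_onI)
      fix t t' assume t: "t \<in> T" "t' \<in> T" "g t = g t'"
      show "t = t'"
        using t clash[of t t'] clash[of t' t] K unfolding g_def by (auto split: if_splits)
    qed
    have "card T \<le> card {0..<K}" by (rule card_inj_on_le[OF ginj gim]) simp
    then have le: "int (card T) \<le> K" using K by simp
    have "\<exists>y\<in>{0..<N}. \<forall>d\<in>{0..<N}. Q (y - d) \<longleftrightarrow> d < K" if eq: "int (card T) = K"
    proof -
      have "card (g ` T) = card {0..<K}" using eq ginj by (simp add: card_image)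
      then have surj: "g ` T = {0..<K}" by (intro card_subset_eq[OF _ gim]) auto
      have one: "t \<in> T \<or> t + (N - K) \<in> T" if "0 \<le> t" "t < K" for t
      proof -
        have "t \<in> g ` T" using surj that by simp
        then obtain t' where "t' \<in> T" "t = g t'" by blast
        then show ?thesis by (auto simp: g_def split: if_splits)
      qed
      \<comment> \<open>The pairing shifted by one: \<open>t\<close> also excludes
        \<open>t - 1 + (N - K)\<close>, at distance \<open>N - K - 1 \<ge> K\<close>, so the pair of
        \<open>t - 1\<close> is represented by \<open>t - 1\<close> itself.\<close>
      have desc: "t - 1 \<in> T" if "t \<in> T" "1 \<le> t" "t < K" for t
      proof -
        have "\<not> (t \<in> T \<and> t - 1 + (N - K) \<in> T)" by (rule clash) (use K in linarith)+
        then show ?thesis using one[of "t - 1"] that by auto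
      qed
      define M where "M = {t \<in> T. t < K}"
      have "finite M" by (rule finite_subset[of _ "{0..<N}"]) (auto simp: M_def T_def)
      moreover have "0 \<in> M" using a K by (simp add: M_def T_def)
      ultimately have Max: "Max M \<in> M" "\<And>t. t \<in> M \<Longrightarrow> t \<le> Max M" by (auto intro: Max_in)
      define m where "m = Max M"
      have m: "m \<in> T" "0 \<le> m" "m < K" "\<And>t. t \<in> T \<Longrightarrow> t < K \<Longrightarrow> t \<le> m"
        using Max by (auto simp: m_def M_def T_def)
      have low: "m - int k \<in> T" if "int k \<le> m" for k
        using that
      proof (induction k)
        case (Suc k)
        then show ?case using desc[of "m - int k"] m by (simp add: algebra_simps)
      qed (use m in simp)
      have block: "Q (a + m - d)" if d: "0 \<le> d" "d < K" for d
      proof (cases "d \<le> m")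
        case True
        then show ?thesis using low[of "nat d"] d by (simp add: T_def algebra_simps)
      next
        case False
        \<comment> \<open>The offset \<open>m - d + K\<close> exceeds the maximum \<open>m\<close>,
          so its partner \<open>m - d + N\<close> is in \<open>T\<close>, and this is
          \<open>m - d\<close> modulo \<open>N\<close>.\<close>
        then have "m - d + K \<notin> T" using m(4)[of "m - d + K"] d by linarith
        then have "m - d + K + (N - K) \<in> T" using one[of "m - d + K"] False d m by auto
        then show ?thesis using perk[of "a + m - d" 1] by (simp add: T_def algebra_simps)
      qed
      have block': "\<not> Q (a + m - d)" if d: "K \<le> d" "d < N" for d
      proof
        assume Qd: "Q (a + m - d)"
        \<comment> \<open>Up to \<open>d = N - K\<close> the start clashes with
          \<open>a + m\<close>; beyond that it clashes with the block start congruent to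
          \<open>a + m - d - K\<close>.\<close>
        have "\<not> d \<le> N - K" using Q[OF Qd block[of 0]] d K by auto
        then have "Q (a + m - (d + K - N))" using block[of "d + K - N"] d by auto
        then have "Q (a + m - d - K)" using perk[of "a + m - (d + K)" 1] by (simp add: algebra_simps)
        then show False using Q[OF _ Qd] K by force
      qed
      have "Q ((a + m) mod N - d) = Q (a + m - d)" for d
      proof -
        have "(a + m) mod N - d + (a + m) div N * N = a + m - d"
          using div_mult_mod_eq[of "a + m" N] by linarith
        then show ?thesis using perk by metis
      qed
      moreover have "Q (a + m - d) \<longleftrightarrow> d < K" if "d \<in> {0..<N}" for d
        using block[of d] block'[of d] that by (cases "d < K") simp_all
      moreover have "(a + m) mod N \<in> {0..<N}" using K by simp
      ultimately show ?thesis by (intro bexI[of _ "(a + m) mod N"]) simp_all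
    qed
    then show ?thesis using le cardT by simp
  qed
  then show "int (card {j \<in> {0..<N}. Q j}) \<le> K"
    "int (card {j \<in> {0..<N}. Q j}) = K \<Longrightarrow>
       \<exists>y\<in>{0..<N}. \<forall>d\<in>{0..<N}. Q (y - d) \<longleftrightarrow> d < K"
    by auto
qed

text \<open>Each disjunct identifies the block \<open>y - K + 1\<close>, ..., \<open>y\<close> as
  the one from \<open>1 - K\<close> to \<open>0\<close>: by both ends, by the upper end and the gap
  after it, or by the lower end and the gap before it.\<close>

lemma cyclic_block_centre:
  fixes Q :: "int \<Rightarrow> bool" and K N :: int
  assumes per: "\<And>i. Q (i + N) = Q i" and K: "1 \<le> K" "2 * K < N"
    and y: "y \<in> {0..<N}" "\<And>d. d \<in> {0..<N} \<Longrightarrow> Q (y - d) \<longleftrightarrow> d < K"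
    and Q: "Q 0 \<and> Q (1 - K) \<or> Q 0 \<and> \<not> Q 1 \<or> Q (1 - K) \<and> \<not> Q (- K)"
  shows "y = 0"
proof (rule ccontr)
  assume "y \<noteq> 0"
  then have y': "0 < y" "y < N" using y(1) by auto
  have win: "Q j \<longleftrightarrow> y - j < K" if "j \<le> y" "y - j < N" for j
    using y(2)[of "y - j"] that by auto
  have Q0: "Q 0 \<longleftrightarrow> y < K" using win[of 0] y' by auto
  have Q1: "Q 1 \<longleftrightarrow> y - 1 < K" using win[of 1] y' by auto
  have A: "Q (1 - K) \<longleftrightarrow> y > N - K"
    using win[of "1 - K"] win[of "1 - K + N"] per[of "1 - K"] y' K
    by (cases "y > N - K") auto
  have A': "Q (- K) \<longleftrightarrow> y \<ge> N - K"
    using win[of "- K"] win[of "- K + N"] per[of "- K"] y' K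
    by (cases "y \<ge> N - K") auto
  show False using Q Q0 Q1 A A' K by linarith
qed

lemma card_cyclic_window:
  fixes K N i :: int
  assumes "0 \<le> K" "K \<le> N" "0 < N"
  shows "int (card {j \<in> {0..<N}. (i - j) mod N < K}) = K"
proof -
  have "bij_betw (\<lambda>j. (i - j) mod N) {j \<in> {0..<N}. (i - j) mod N < K} {0..<K}"
    by (rule bij_betw_byWitness[where f' = "\<lambda>t. (i - t) mod N"])
      (use assms in \<open>auto simp: mod_simps\<close>)
  then show ?thesis using assms(1) by (simp add: bij_betw_same_card)
qed

section \<open>Cyclic arrangements of the edges\<close>

text \<open>An arrangement lists the edges with one chosen endpoint each.  Listing every chosen endpoint
  followed by its mate places the \<open>2 n\<close> vertices on a cycle; \<open>pt\<close> reads this cycle with indices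
  modulo \<open>2 n\<close>.\<close>

definition arrangements :: "nat \<Rightarrow> vertex list set" where
  "arrangements n = {ws. length ws = n \<and> distinct (map idx ws) \<and> set ws \<subseteq> M_verts n}"

definition slot :: "vertex list \<Rightarrow> int \<Rightarrow> vertex" where
  "slot ws m = ws ! nat (m mod int (length ws))"

definition pt :: "vertex list \<Rightarrow> int \<Rightarrow> vertex" where
  "pt ws i = (if even i then slot ws (i div 2) else mate (slot ws (i div 2)))"

definition arc :: "nat \<Rightarrow> vertex list \<Rightarrow> int \<Rightarrow> vertex set" where
  "arc p ws j = pt ws ` {j..j + 2 * int p}"

lemma arrangementsD:
  assumes "ws \<in> arrangements n"
  shows "length ws = n" "distinct (map idx ws)" "idx ` set ws = {1..n}"
proof -
  show 1: "length ws = n" "distinct (map idx ws)" using assms by (auto simp: arrangements_def)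
  have "idx ` set ws \<subseteq> {1..n}" using assms by (auto simp: arrangements_def)
  moreover have "card (idx ` set ws) = n"
    using distinct_card[OF 1(2)] 1(1) by simp
  ultimately show "idx ` set ws = {1..n}"
    by (intro card_subset_eq) simp_all
qed

lemma finite_arrangements: "finite (arrangements n)"
proof (rule finite_subset)
  show "arrangements n \<subseteq> {ws. set ws \<subseteq> M_verts n \<and> length ws = n}"
    by (auto simp only: arrangements_def)
  show "finite {ws. set ws \<subseteq> M_verts n \<and> length ws = n}"
    by (rule finite_lists_length_eq[OF finite_M_verts])
qed

text \<open>A position on the cycle splits into its slot modulo \<open>n\<close> and a parity that
  selects the chosen endpoint or its mate.\<close>

lemma mod_two_eq_iff:
  fixes i j n :: int
  assumes "n > 0"
  shows "i mod (2 * n) = j mod (2 * n) \<longleftrightarrow> (even i \<longleftrightarrow> even j) \<and> i div 2 mod n = j div 2 mod n"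
proof -
  have e: "i mod (2 * n) = 2 * (i div 2 mod n) + i mod 2" for i :: int
    using zmod_zmult2_eq[of n i 2] assms by simp
  have "(even i \<longleftrightarrow> even j) \<longleftrightarrow> i mod 2 = j mod 2" by presburger
  moreover have "2 * a + i mod 2 = 2 * b + j mod 2 \<longleftrightarrow> a = b \<and> i mod 2 = j mod 2" for a b :: int
    by presburger
  ultimately show ?thesis by (simp add: e conj_commute)
qed

context
  fixes ws n
  assumes ws: "ws \<in> arrangements n" and n: "n > 0"
begin

lemma slot_in: "slot ws m \<in> set ws"
  using arrangementsD(1)[OF ws] n by (auto simp: slot_def intro!: nth_mem simp: nat_less_iff)

lemma idx_slot_in: "idx (slot ws m) \<in> {1..n}"
  using slot_in arrangementsD(3)[OF ws] by blast

lemma idx_slot_eq_iff: "idx (slot ws i) = idx (slot ws j) \<longleftrightarrow> i mod int n = j mod int n"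
proof -
  have "nat (i mod int n) < n" "nat (j mod int n) < n" using n by (auto simp: nat_less_iff)
  then have "map idx ws ! nat (i mod int n) = map idx ws ! nat (j mod int n) \<longleftrightarrow>
      nat (i mod int n) = nat (j mod int n)"
    using arrangementsD[OF ws] by (intro nth_eq_iff_index_eq) auto
  then show ?thesis
    using arrangementsD(1)[OF ws] n \<open>nat (i mod int n) < n\<close> \<open>nat (j mod int n) < n\<close>
    by (simp add: slot_def eq_nat_nat_iff)
qed

lemma slot_image: "slot ws ` {int a..<int b} = set (take (b - a) (drop a ws))" if "a \<le> b" "b \<le> n"
proof -
  have len: "length ws = n" by (rule arrangementsD(1)[OF ws])
  have "slot ws ` {int a..<int b} = (slot ws \<circ> int) ` {a..<b}"
    by (simp only: image_comp[symmetric] image_int_atLeastLessThan)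
  also have "\<dots> = (!) ws ` {a..<b}"
    using that len by (intro image_cong) (auto simp: slot_def)
  also have "{a..<b} = (+) a ` {0..<b - a}" using that by simp
  also have "(!) ws ` (+) a ` {0..<b - a} = (!) (drop a ws) ` {0..<b - a}"
    unfolding image_image using that len by (intro image_cong) simp_all
  also have "\<dots> = set (take (b - a) (drop a ws))"
    using that len by (intro nth_image) simp
  finally show ?thesis .
qed

lemma pt_eq_iff: "pt ws i = pt ws j \<longleftrightarrow> i mod (2 * int n) = j mod (2 * int n)"
proof -
  have n': "int n > 0" using n by simp
  have "idx (slot ws (i div 2)) = idx (slot ws (j div 2)) \<longleftrightarrow> i div 2 mod int n = j div 2 mod int n"
    by (rule idx_slot_eq_iff)
  moreover have "slot ws (i div 2) = slot ws (j div 2)" if "i div 2 mod int n = j div 2 mod int n"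
    using that arrangementsD(1)[OF ws] by (simp add: slot_def)
  ultimately show ?thesis
    unfolding mod_two_eq_iff[OF n'] by (cases "even i"; cases "even j") (auto simp: pt_def dest: arg_cong[of _ _ idx])
qed

lemma pt_in: "pt ws i \<in> M_verts n"
  using idx_slot_in by (simp add: pt_def)

lemma pt_surj: "v \<in> M_verts n \<Longrightarrow> \<exists>i. v = pt ws i"
proof -
  assume "v \<in> M_verts n"
  then have "idx v \<in> idx ` set ws" using arrangementsD(3)[OF ws] by simp
  then obtain m where m: "m < n" "idx v = idx (ws ! m)"
    using arrangementsD(1)[OF ws] by (auto simp: in_set_conv_nth)
  have "slot ws (int m) = ws ! m" using m arrangementsD(1)[OF ws] by (simp add: slot_def)
  then have "pt ws (2 * int m) = ws ! m" "pt ws (2 * int m + 1) = mate (ws ! m)"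
    by (simp_all add: pt_def)
  then show ?thesis using m by (metis idx_eq_iff)
qed

lemma arc_periodic: "arc p ws (j + 2 * int n) = arc p ws j"
proof -
  have "arc p ws (j + 2 * int n) = pt ws ` ((\<lambda>i. i + 2 * int n) ` {j..j + 2 * int p})"
    unfolding arc_def image_add_atLeastAtMost' by (simp add: ac_simps)
  also have "\<dots> = arc p ws j"
    unfolding image_image arc_def by (intro image_cong) (simp_all add: pt_eq_iff)
  finally show ?thesis .
qed

text \<open>An even start is the chosen endpoint of slot \<open>m\<close>, so
  \<open>2 * p + 1\<close> vertices fill \<open>p\<close> slots and spill one chosen endpoint over
  the end.\<close>

lemma arc_even: "arc p ws (2 * m) =
    insert (slot ws (m + int p)) (idx -` idx ` slot ws ` {m..<m + int p})"
proof (intro equalityI subsetI)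
  fix v assume "v \<in> arc p ws (2 * m)"
  then obtain i where i: "2 * m \<le> i" "i \<le> 2 * m + 2 * int p" "v = pt ws i" by (auto simp: arc_def)
  show "v \<in> insert (slot ws (m + int p)) (idx -` idx ` slot ws ` {m..<m + int p})"
  proof (cases "i = 2 * m + 2 * int p")
    case False
    then have "i div 2 \<in> {m..<m + int p}" using i by auto
    then show ?thesis using i(3) by (auto simp: pt_def)
  qed (use i in \<open>simp add: pt_def\<close>)
next
  fix v assume v: "v \<in> insert (slot ws (m + int p)) (idx -` idx ` slot ws ` {m..<m + int p})"
  have A: "pt ws i \<in> arc p ws (2 * m)" if "2 * m \<le> i" "i \<le> 2 * m + 2 * int p" for i
    using that by (auto simp: arc_def)
  show "v \<in> arc p ws (2 * m)"
  proof (cases "v = slot ws (m + int p)")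
    case True
    then show ?thesis using A[of "2 * (m + int p)"] by (simp add: pt_def)
  next
    case False
    then obtain k where k: "m \<le> k" "k < m + int p" "idx v = idx (slot ws k)" using v by auto
    then show ?thesis using A[of "2 * k"] A[of "2 * k + 1"] by (auto simp: idx_eq_iff pt_def)
  qed
qed

text \<open>An odd start is the second endpoint of slot \<open>m - 1\<close>, so the surplus vertex
  sits at the front and is a mate.\<close>

lemma arc_odd: "arc p ws (2 * m - 1) =
    insert (mate (slot ws (m - 1))) (idx -` idx ` slot ws ` {m..<m + int p})"
proof (intro equalityI subsetI)
  fix v assume "v \<in> arc p ws (2 * m - 1)"
  then obtain i where i: "2 * m - 1 \<le> i" "i \<le> 2 * m - 1 + 2 * int p" "v = pt ws i"
    by (auto simp: arc_def)
  show "v \<in> insert (mate (slot ws (m - 1))) (idx -` idx ` slot ws ` {m..<m + int p})"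
  proof (cases "i = 2 * m - 1")
    case True
    then have "odd i" "i div 2 = m - 1" by presburger+
    then show ?thesis using i(3) by (simp add: pt_def)
  next
    case False
    then have "i div 2 \<in> {m..<m + int p}" using i by auto
    then show ?thesis using i(3) by (auto simp: pt_def)
  qed
next
  fix v assume v: "v \<in> insert (mate (slot ws (m - 1))) (idx -` idx ` slot ws ` {m..<m + int p})"
  have A: "pt ws i \<in> arc p ws (2 * m - 1)" if "2 * m - 1 \<le> i" "i \<le> 2 * m - 1 + 2 * int p" for i
    using that by (auto simp: arc_def)
  show "v \<in> arc p ws (2 * m - 1)"
  proof (cases "v = mate (slot ws (m - 1))")
    case True
    have "(2 * m - 1) div 2 = m - 1" by presburger
    then show ?thesis using A[of "2 * m - 1"] True by (simp add: pt_def)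
  next
    case False
    then obtain k where k: "m \<le> k" "k < m + int p" "idx v = idx (slot ws k)" using v by auto
    then show ?thesis using A[of "2 * k"] A[of "2 * k + 1"] by (auto simp: idx_eq_iff pt_def)
  qed
qed

lemma idx_slot_neq: "idx (slot ws i) \<noteq> idx (slot ws j)" if "i < j" "j - i < int n"
proof
  assume "idx (slot ws i) = idx (slot ws j)"
  then have "int n dvd j - i" unfolding idx_slot_eq_iff by (metis mod_eq_dvd_iff)
  then have "int n \<le> j - i" using that by (intro zdvd_imp_le) auto
  then show False using that by linarith
qed

lemma slot_nth: "k < n \<Longrightarrow> slot ws (int k) = ws ! k"
  using arrangementsD(1)[OF ws] by (simp add: slot_def)

lemma slot_block:
  assumes "p < n"
  shows "card (idx ` slot ws ` {m..<m + int p}) = p"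
    and "idx (slot ws (m + int p)) \<notin> idx ` slot ws ` {m..<m + int p}"
    and "idx (slot ws (m - 1)) \<notin> idx ` slot ws ` {m..<m + int p}"
proof -
  have "inj_on (idx \<circ> slot ws) {m..<m + int p}"
  proof (rule linorder_inj_onI)
    fix i j assume "i < j" "i \<in> {m..<m + int p}" "j \<in> {m..<m + int p}"
    then show "(idx \<circ> slot ws) i \<noteq> (idx \<circ> slot ws) j"
      using idx_slot_neq[of i j] assms by simp
  qed auto
  then have "card ((idx \<circ> slot ws) ` {m..<m + int p}) = card {m..<m + int p}"
    by (rule card_image)
  then show "card (idx ` slot ws ` {m..<m + int p}) = p"
    by (simp only: image_comp card_atLeastLessThan_int)
  show "idx (slot ws (m + int p)) \<notin> idx ` slot ws ` {m..<m + int p}"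
  proof
    assume "idx (slot ws (m + int p)) \<in> idx ` slot ws ` {m..<m + int p}"
    then obtain k where "m \<le> k" "k < m + int p" "idx (slot ws k) = idx (slot ws (m + int p))"
      by force
    then show False using idx_slot_neq[of k "m + int p"] assms by simp
  qed
  show "idx (slot ws (m - 1)) \<notin> idx ` slot ws ` {m..<m + int p}"
  proof
    assume "idx (slot ws (m - 1)) \<in> idx ` slot ws ` {m..<m + int p}"
    then obtain k where "m \<le> k" "k < m + int p" "idx (slot ws (m - 1)) = idx (slot ws k)"
      by force
    then show False using idx_slot_neq[of "m - 1" k] assms by simp
  qed
qed

lemma arc_in_matching_family:
  assumes "p < n"
  shows "arc p ws j \<in> matching_family p 1 n"
proof -
  define m where "m = (j + 1) div 2"
  define P where "P = idx ` slot ws ` {m..<m + int p}"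
  have P: "P \<subseteq> {1..n}" "card P = p" "idx (slot ws (m + int p)) \<notin> P" "idx (slot ws (m - 1)) \<notin> P"
    using slot_block[OF assms, of m] idx_slot_in unfolding P_def by blast+
  have "j = 2 * m \<or> j = 2 * m - 1" unfolding m_def by presburger
  then have "arc p ws j = insert (slot ws (m + int p)) (idx -` P) \<or>
      arc p ws j = insert (mate (slot ws (m - 1))) (idx -` P)"
    unfolding P_def by (elim disjE) (simp_all only: arc_even arc_odd simp_thms)
  moreover have "idx (slot ws (m + int p)) \<in> {1..n} - P" "idx (mate (slot ws (m - 1))) \<in> {1..n} - P"
    using P idx_slot_in by simp_all
  ultimately show ?thesis unfolding matching_family_1_iff using P(1,2) by blast
qed

text \<open>Positions of the two arcs differ by at least \<open>1\<close> and at most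
  \<open>2 * int n - 1\<close>, so they never agree modulo \<open>2 * int n\<close>.\<close>

lemma arcs_disjoint:
  assumes "2 * int p + 1 \<le> j - i" "j - i \<le> 2 * int n - (2 * int p + 1)"
  shows "arc p ws i \<inter> arc p ws j = {}"
proof -
  have "k mod (2 * int n) \<noteq> l mod (2 * int n)"
    if "k \<in> {i..i + 2 * int p}" "l \<in> {j..j + 2 * int p}" for k l
  proof
    assume "k mod (2 * int n) = l mod (2 * int n)"
    then have "2 * int n dvd l - k" by (metis mod_eq_dvd_iff)
    then have "2 * int n \<le> l - k" using that assms by (intro zdvd_imp_le) auto
    then show False using that assms by auto
  qed
  then show ?thesis by (auto simp: arc_def pt_eq_iff)
qed

lemma mem_arc_iff:
  assumes "p < n"
  shows "pt ws i \<in> arc p ws j \<longleftrightarrow> (i - j) mod (2 * int n) < 2 * int p + 1"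
proof
  assume "pt ws i \<in> arc p ws j"
  then obtain k where k: "j \<le> k" "k \<le> j + 2 * int p" "i mod (2 * int n) = k mod (2 * int n)"
    by (auto simp: arc_def pt_eq_iff)
  then have "(i - j) mod (2 * int n) = (k - j) mod (2 * int n)" by (metis mod_diff_left_eq)
  also have "\<dots> = k - j" using k assms by (intro mod_pos_pos_trivial) auto
  finally show "(i - j) mod (2 * int n) < 2 * int p + 1" using k by simp
next
  assume *: "(i - j) mod (2 * int n) < 2 * int p + 1"
  have "pt ws i = pt ws (j + (i - j) mod (2 * int n))"
    unfolding pt_eq_iff by (simp add: mod_simps)
  moreover have "j + (i - j) mod (2 * int n) \<in> {j..j + 2 * int p}" using * n by simp
  ultimately show "pt ws i \<in> arc p ws j" unfolding arc_def by blast
qed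

end

section \<open>Symmetries and completion of arrangements\<close>

text \<open>Rotating the list by one slot moves the cycle by two positions, so only even
  translations arise.\<close>

lemma rotate_arrangement:
  assumes ws: "ws \<in> arrangements n" and n: "n > 0"
  shows "\<exists>ws'\<in>arrangements n. \<forall>j. arc p ws' j = arc p ws (j + 2 * m)"
proof -
  define k where "k = nat (m mod int n)"
  have len: "length ws = n" by (rule arrangementsD(1)[OF ws])
  have k: "int k = m mod int n" using n by (simp add: k_def)
  have "rotate k ws \<in> arrangements n"
    using ws by (simp add: arrangements_def flip: rotate_map)
  moreover have "arc p (rotate k ws) j = arc p ws (j + 2 * m)" for j
  proof -
    have "slot (rotate k ws) i = slot ws (i + m)" for i
    proof -
      have "(k + nat (i mod int n)) mod n = nat ((i + m) mod int n)"
      proof -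
        have "int ((k + nat (i mod int n)) mod n) = (m mod int n + i mod int n) mod int n"
          using n by (simp add: k zmod_int)
        also have "\<dots> = (i + m) mod int n" by (simp add: mod_simps add.commute)
        finally show ?thesis by linarith
      qed
      then show ?thesis using n len by (simp add: slot_def nth_rotate nat_less_iff add.commute)
    qed
    then have "pt (rotate k ws) = pt ws \<circ> (\<lambda>i. i + 2 * m)"
      by (simp add: pt_def add.commute fun_eq_iff)
    then have "arc p (rotate k ws) j = pt ws ` ((\<lambda>i. i + 2 * m) ` {j..j + 2 * int p})"
      by (simp only: arc_def image_comp)
    also have "(\<lambda>i. i + 2 * m) ` {j..j + 2 * int p} = {j + 2 * m..j + 2 * m + 2 * int p}"
      by (simp add: ac_simps)
    finally show ?thesis by (simp only: arc_def)
  qed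
  ultimately show ?thesis by blast
qed

text \<open>Reversing the list and swapping endpoints reads the cycle backwards; \<open>i\<close>
  becomes \<open>- 1 - i\<close>, which exchanges the parities. This handles centres at odd
  positions.\<close>

lemma reflect_arrangement:
  assumes ws: "ws \<in> arrangements n" and n: "n > 0"
  shows "\<exists>ws'\<in>arrangements n. \<forall>j. arc p ws' j = arc p ws (- 1 - j - 2 * int p)"
proof -
  let ?ws' = "rev (map mate ws)"
  have len: "length ws = n" by (rule arrangementsD(1)[OF ws])
  have "map idx ?ws' = rev (map idx ws)" by (simp add: rev_map comp_def)
  then have "distinct (map idx ?ws')" using arrangementsD(2)[OF ws] by (simp only: distinct_rev)
  then have "?ws' \<in> arrangements n"
    using ws by (auto simp: arrangements_def simp del: map_map)
  moreover have "arc p ?ws' j = arc p ws (- 1 - j - 2 * int p)" for j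
  proof -
    have "slot ?ws' i = mate (slot ws (- 1 - i))" for i
    proof -
      have Y: "0 \<le> i mod int n" "i mod int n < int n" using n by simp_all
      then have lt: "nat (i mod int n) < n" by linarith
      have "(- 1 - i) mod int n = int n - 1 - i mod int n"
      proof -
        have "(- 1 - i) mod int n = (int n + (- 1 - i)) mod int n"
          by (rule mod_add_self1[symmetric])
        also have "\<dots> = (int n - 1 - i) mod int n" by (rule arg_cong[of _ _ "\<lambda>k. k mod int n"]) simp
        also have "\<dots> = (int n - 1 - i mod int n) mod int n" by (simp add: mod_simps)
        also have "\<dots> = int n - 1 - i mod int n" using Y n by (intro mod_pos_pos_trivial) linarith+
        finally show ?thesis .
      qed
      then have "nat ((- 1 - i) mod int n) = n - Suc (nat (i mod int n))"
        using lt Y by arith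
      then show ?thesis using lt len n by (simp add: slot_def rev_nth)
    qed
    moreover have "(- 1 - i) div 2 = - 1 - i div 2" "even (- 1 - i) \<longleftrightarrow> odd i" for i :: int
      by presburger+
    ultimately have "pt ?ws' = pt ws \<circ> (\<lambda>i. - 1 - i)"
      by (simp add: pt_def fun_eq_iff)
    then have "arc p ?ws' j = pt ws ` ((\<lambda>i. - 1 - i) ` {j..j + 2 * int p})"
      by (simp only: arc_def image_comp)
    also have "(\<lambda>i. - 1 - i) ` {j..j + 2 * int p} =
        {- 1 - j - 2 * int p..- 1 - j - 2 * int p + 2 * int p}"
      by (simp add: algebra_simps)
    finally show ?thesis by (simp only: arc_def)
  qed
  ultimately show ?thesis by blast
qed

text \<open>The endpoint \<open>L\<close> is an arbitrary choice: these lists fill slots of which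
  only the edge matters.\<close>

definition edge_list :: "nat set \<Rightarrow> vertex list" where
  "edge_list Q = map L (sorted_list_of_set Q)"

lemma edge_list:
  assumes "finite Q"
  shows "length (edge_list Q) = card Q" "idx ` set (edge_list Q) = Q" "distinct (map idx (edge_list Q))"
proof -
  have "map idx (edge_list Q) = sorted_list_of_set Q" by (simp add: edge_list_def comp_def)
  then show "distinct (map idx (edge_list Q))" "idx ` set (edge_list Q) = Q"
    using assms by (simp_all only: distinct_sorted_list_of_set set_map[symmetric] set_sorted_list_of_set)
qed (simp add: edge_list_def)

lemma arrangement_extend:
  assumes "distinct (map idx (us @ vs))" "idx ` set (us @ vs) \<subseteq> {1..n}"
  shows "\<exists>ms. us @ ms @ vs \<in> arrangements n"
proof -
  let ?D = "{1..n} - idx ` set (us @ vs)"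
  have fin: "finite ?D" by simp
  have "card (idx ` set (us @ vs)) = length (us @ vs)"
    using distinct_card[OF assms(1)] by (simp only: set_map length_map)
  then have "card ?D = n - length (us @ vs)" "length (us @ vs) \<le> n"
    using assms(2) card_mono[OF _ assms(2)] by (simp_all add: card_Diff_subset)
  then have "length (us @ edge_list ?D @ vs) = n" using edge_list(1)[OF fin] by simp
  moreover have "distinct (map idx (us @ edge_list ?D @ vs))"
  proof -
    have "idx ` set (edge_list ?D) \<inter> idx ` set (us @ vs) = {}" using edge_list(2)[OF fin] by blast
    then show ?thesis using assms(1) edge_list(3)[OF fin] by (simp only: map_append distinct_append set_map set_append) blast
  qed
  moreover have "set (us @ edge_list ?D @ vs) \<subseteq> M_verts n"
  proof
    fix v assume "v \<in> set (us @ edge_list ?D @ vs)"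
    then have "idx v \<in> idx ` set (us @ vs) \<union> idx ` set (edge_list ?D)" by auto
    then show "v \<in> M_verts n" using assms(2) edge_list(2)[OF fin] by auto
  qed
  ultimately show ?thesis unfolding arrangements_def by blast
qed

text \<open>List the edges of \<open>P\<close> first and then \<open>v\<close>; the arc from
  \<open>0\<close> covers exactly these.\<close>

lemma matching_family_arc:
  assumes "H \<in> matching_family p 1 n"
  shows "\<exists>ws\<in>arrangements n. arc p ws 0 = H"
proof -
  obtain P v where H: "P \<subseteq> {1..n}" "card P = p" "idx v \<in> {1..n} - P" "H = insert v (idx -` P)"
    using assms unfolding matching_family_1_iff by blast
  have fin: "finite P" using H(1) finite_subset by blast
  note el = edge_list[OF fin]
  have "distinct (map idx ((edge_list P @ [v]) @ []))"
    using el(2,3) H(3) by auto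
  moreover have "idx ` set ((edge_list P @ [v]) @ []) \<subseteq> {1..n}" using el(2) H(1,3) by auto
  ultimately obtain ms where ws: "(edge_list P @ [v]) @ ms @ [] \<in> arrangements n"
    using arrangement_extend by blast
  define ws where "ws = edge_list P @ [v] @ ms"
  have w: "ws \<in> arrangements n" using ws by (simp add: ws_def)
  have n: "p < n" using arrangementsD(1)[OF w] el(1) H(2) by (simp add: ws_def)
  have n0: "0 < n" using n by simp
  have "arc p ws 0 = insert (slot ws (int p)) (idx -` idx ` slot ws ` {0..<int p})"
    using arc_even[OF w n0, of p 0] by simp
  also have "slot ws (int p) = v"
    using slot_nth[OF w n0 n] el(1) H(2) by (simp add: ws_def nth_append)
  also have "slot ws ` {0..<int p} = set (edge_list P)"
    using slot_image[OF w n0, of 0 p] n el(1) H(2) by (simp add: ws_def)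
  finally show ?thesis using w el(2) H(4) by auto
qed

text \<open>Sending position \<open>i\<close> of one cycle to position \<open>i\<close> of the other
  is well defined, since positions coincide modulo \<open>2 * int n\<close> on both, and it commutes
  with \<open>mate\<close>. So it is an automorphism of the matching.\<close>

lemma arrangement_automorphism:
  assumes ws: "ws \<in> arrangements n" and ws': "ws' \<in> arrangements n" and n: "n > 0"
  shows "\<exists>\<tau>. (\<forall>i. \<tau> (pt ws i) = pt ws' i) \<and> inj_on \<tau> (M_verts n) \<and>
           (\<forall>us\<in>arrangements n. map \<tau> us \<in> arrangements n \<and> (\<forall>j. arc p (map \<tau> us) j = \<tau> ` arc p us j))"
proof -
  define \<tau> where "\<tau> = (\<lambda>v. pt ws' (SOME i. pt ws i = v))"
  have \<tau>: "\<tau> (pt ws i) = pt ws' i" for i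
  proof -
    have "pt ws (SOME k. pt ws k = pt ws i) = pt ws i" by (rule someI) (rule refl)
    then show ?thesis unfolding \<tau>_def by (simp only: pt_eq_iff[OF ws n] pt_eq_iff[OF ws' n])
  qed
  have inj: "inj_on \<tau> (M_verts n)"
  proof (rule inj_onI)
    fix v w assume "v \<in> M_verts n" "w \<in> M_verts n" and eq: "\<tau> v = \<tau> w"
    then obtain i j where "v = pt ws i" "w = pt ws j" using pt_surj[OF ws n] by blast
    then show "v = w" using eq by (simp add: \<tau> pt_eq_iff[OF ws n] pt_eq_iff[OF ws' n])
  qed
  have into: "\<tau> v \<in> M_verts n" if v: "v \<in> M_verts n" for v
  proof -
    obtain i where "v = pt ws i" using pt_surj[OF ws n v] by blast
    then show ?thesis using pt_in[OF ws' n] by (simp only: \<tau>)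
  qed
  have mate: "\<tau> (mate v) = mate (\<tau> v)" if v: "v \<in> M_verts n" for v
  proof -
    have m: "mate (pt us i) = pt us (if even i then i + 1 else i - 1)" for us i
      unfolding pt_def by (cases "even i") (auto elim!: oddE)
    obtain i where "v = pt ws i" using pt_surj[OF ws n v] by blast
    then show ?thesis by (simp only: m \<tau>)
  qed
  have "map \<tau> us \<in> arrangements n \<and> (\<forall>j. arc p (map \<tau> us) j = \<tau> ` arc p us j)"
    if us: "us \<in> arrangements n" for us
  proof -
    have len: "length us = n" by (rule arrangementsD(1)[OF us])
    have sub: "set us \<subseteq> M_verts n" using us by (simp add: arrangements_def)
    have "inj_on idx (set us)" using arrangementsD(2)[OF us] by (simp add: distinct_map)
    have "inj_on (idx \<circ> \<tau>) (set us)"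
    proof (rule inj_onI)
      fix v w assume vw: "v \<in> set us" "w \<in> set us" "(idx \<circ> \<tau>) v = (idx \<circ> \<tau>) w"
      then have V: "v \<in> M_verts n" "w \<in> M_verts n" "mate w \<in> M_verts n" using sub by auto
      have "\<tau> v = \<tau> w \<or> \<tau> v = \<tau> (mate w)" using vw(3) mate[OF V(2)] by (simp add: idx_eq_iff)
      then have "v = w \<or> v = mate w" using inj V by (auto dest: inj_onD)
      then have "idx v = idx w" by auto
      then show "v = w" using \<open>inj_on idx (set us)\<close> vw by (auto dest: inj_onD)
    qed
    then have "distinct (map idx (map \<tau> us))"
      using arrangementsD(2)[OF us] by (simp add: distinct_map)
    moreover have "set (map \<tau> us) \<subseteq> M_verts n" using sub into by auto
    ultimately have 1: "map \<tau> us \<in> arrangements n" using len by (simp add: arrangements_def)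
    have "slot (map \<tau> us) m = \<tau> (slot us m)" for m
      using len n by (simp add: slot_def nat_less_iff)
    moreover have "slot us m \<in> M_verts n" for m using slot_in[OF us n] sub by blast
    ultimately have "pt (map \<tau> us) = \<tau> \<circ> pt us"
      by (simp add: pt_def fun_eq_iff mate del: mem_M_verts_iff)
    then have "arc p (map \<tau> us) j = \<tau> ` arc p us j" for j
      by (simp only: arc_def image_comp)
    then show ?thesis using 1 by blast
  qed
  then show ?thesis using \<tau> inj by blast
qed

section \<open>Double counting of arcs over all arrangements\<close>

text \<open>Realise both sets as arcs from \<open>0\<close>; the automorphism between the two cycles
  takes \<open>H\<close> to \<open>H'\<close> and embeds the representations of \<open>H\<close>
  into those of \<open>H'\<close>.\<close>

lemma card_arc_fibre:
  assumes "H \<in> matching_family p 1 n" "H' \<in> matching_family p 1 n" and n: "n > 0"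
  shows "card {(ws, j) \<in> arrangements n \<times> {0..<2 * int n}. arc p ws j = H} \<le>
         card {(ws, j) \<in> arrangements n \<times> {0..<2 * int n}. arc p ws j = H'}"
proof -
  obtain ws ws' where w: "ws \<in> arrangements n" "arc p ws 0 = H" "ws' \<in> arrangements n" "arc p ws' 0 = H'"
    using matching_family_arc assms(1,2) by blast
  obtain \<tau> where \<tau>: "\<forall>i. \<tau> (pt ws i) = pt ws' i" "inj_on \<tau> (M_verts n)"
    "\<forall>us\<in>arrangements n. map \<tau> us \<in> arrangements n \<and> (\<forall>j. arc p (map \<tau> us) j = \<tau> ` arc p us j)"
    using arrangement_automorphism[OF w(1,3) n, of p] by (elim exE conjE)
  have H': "\<tau> ` H = H'" using w \<tau>(1) by (auto simp: arc_def image_image)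
  show ?thesis
  proof (rule card_inj_on_le)
    show "inj_on (map_prod (map \<tau>) id) {(ws, j) \<in> arrangements n \<times> {0..<2 * int n}. arc p ws j = H}"
    proof (rule inj_onI, clarsimp)
      fix us vs assume *: "us \<in> arrangements n" "vs \<in> arrangements n" "map \<tau> us = map \<tau> vs"
      then have "set us \<union> set vs \<subseteq> M_verts n" by (simp add: arrangements_def)
      then have "inj_on \<tau> (set us \<union> set vs)" using \<tau>(2) inj_on_subset by blast
      then show "us = vs" using *(3) map_inj_on by blast
    qed
    show "map_prod (map \<tau>) id ` {(ws, j) \<in> arrangements n \<times> {0..<2 * int n}. arc p ws j = H} \<subseteq>
        {(ws, j) \<in> arrangements n \<times> {0..<2 * int n}. arc p ws j = H'}"
      using \<tau>(3) H' by auto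
    show "finite {(ws, j) \<in> arrangements n \<times> {0..<2 * int n}. arc p ws j = H'}"
      by (rule finite_subset[of _ "arrangements n \<times> {0..<2 * int n}"]) (auto simp: finite_arrangements)
  qed
qed

text \<open>Group the pairs of arrangement and start by their arc: by symmetry each member has the
  same number \<open>c\<close> of representations. One \<open>c\<close> serves all
  \<open>\<F>\<close>, so families can be compared.\<close>

lemma sum_card_arcs:
  assumes n: "n > 0"
  shows "\<exists>c. \<forall>\<F> \<subseteq> matching_family p 1 n.
    (\<Sum>ws\<in>arrangements n. card {j \<in> {0..<2 * int n}. arc p ws j \<in> \<F>}) = card \<F> * c"
proof -
  let ?J = "{0..<2 * int n}"
  have finJ: "finite {j \<in> ?J. Q j}" for Q
    by (rule finite_subset[of _ ?J]) auto
  define fib where "fib = (\<lambda>H. {(ws, j) \<in> arrangements n \<times> ?J. arc p ws j = H})"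
  have fin: "finite (fib H)" for H
    unfolding fib_def
    by (rule finite_subset[of _ "arrangements n \<times> {0..<2 * int n}"]) (auto simp: finite_arrangements)
  have "card (fib H) = card (fib H')" if "H \<in> matching_family p 1 n" "H' \<in> matching_family p 1 n" for H H'
    unfolding fib_def using card_arc_fibre that n by (simp add: le_antisym)
  then obtain c where c: "\<And>H. H \<in> matching_family p 1 n \<Longrightarrow> card (fib H) = c" by metis
  have "(\<Sum>ws\<in>arrangements n. card {j \<in> ?J. arc p ws j \<in> \<F>}) = card \<F> * c"
    if F: "\<F> \<subseteq> matching_family p 1 n" for \<F>
  proof -
    have "(\<Sum>ws\<in>arrangements n. card {j \<in> ?J. arc p ws j \<in> \<F>}) =
        card (SIGMA ws:arrangements n. {j \<in> ?J. arc p ws j \<in> \<F>})"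
      by (rule card_SigmaI[symmetric, OF finite_arrangements]) (intro ballI finJ)
    also have "(SIGMA ws:arrangements n. {j \<in> ?J. arc p ws j \<in> \<F>}) = (\<Union>H\<in>\<F>. fib H)"
      unfolding fib_def by auto
    also have "card \<dots> = (\<Sum>H\<in>\<F>. card (fib H))"
      using F finite_matching_family finite_subset fin
      by (intro card_UN_disjoint) (fastforce simp: fib_def)+
    also have "\<dots> = (\<Sum>H\<in>\<F>. c)" using F c by (intro sum.cong) auto
    finally show ?thesis by simp
  qed
  then show ?thesis by blast
qed

text \<open>Stars attain the bound on every single cycle, which makes the averaging sharp.\<close>

lemma card_arcs_star:
  assumes ws: "ws \<in> arrangements n" and n: "p < n" and x: "x \<in> M_verts n"
  shows "card {j \<in> {0..<2 * int n}. arc p ws j \<in> star (matching_family p 1 n) x} = 2 * p + 1"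
proof -
  have n0: "n > 0" using n by simp
  obtain i where i: "x = pt ws i" using pt_surj[OF ws n0 x] by blast
  have "arc p ws j \<in> star (matching_family p 1 n) x \<longleftrightarrow> (i - j) mod (2 * int n) < 2 * int p + 1" for j
    using mem_arc_iff[OF ws n0 n] arc_in_matching_family[OF ws n0 n] by (simp add: star_def i)
  then show ?thesis
    using card_cyclic_window[of "2 * int p + 1" "2 * int n" i] n by simp
qed

text \<open>The cyclic result with \<open>K = 2 * p + 1\<close> and \<open>N = 2 * n\<close>; the
  hypothesis on \<open>n\<close> says precisely \<open>2 * K < N\<close>.\<close>

lemma card_arcs_intersecting:
  assumes ws: "ws \<in> arrangements n" and n: "n > 2 * p + 1" and F: "intersecting \<F>"
  shows "card {j \<in> {0..<2 * int n}. arc p ws j \<in> \<F>} \<le> 2 * p + 1"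
    and "card {j \<in> {0..<2 * int n}. arc p ws j \<in> \<F>} = 2 * p + 1 \<Longrightarrow>
      \<exists>y\<in>{0..<2 * int n}. \<forall>d\<in>{0..<2 * int n}. arc p ws (y - d) \<in> \<F> \<longleftrightarrow> d < 2 * int p + 1"
proof -
  have n0: "n > 0" using n by simp
  have per: "arc p ws (i + 2 * int n) \<in> \<F> \<longleftrightarrow> arc p ws i \<in> \<F>" for i
    using arc_periodic[OF ws n0] by simp
  have K: "1 \<le> 2 * int p + 1" "2 * (2 * int p + 1) < 2 * int n" using n by auto
  have dis: False if "arc p ws i \<in> \<F>" "arc p ws j \<in> \<F>" "2 * int p + 1 \<le> j - i"
    "j - i \<le> 2 * int n - (2 * int p + 1)" for i j
    using arcs_disjoint[OF ws n0 that(3,4)] that(1,2) F by (auto simp: intersecting_def)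
  have "int (card {j \<in> {0..<2 * int n}. arc p ws j \<in> \<F>}) \<le> 2 * int p + 1"
    by (rule card_cyclic_intersecting[where Q = "\<lambda>j. arc p ws j \<in> \<F>", OF per K]) (rule dis)
  then show "card {j \<in> {0..<2 * int n}. arc p ws j \<in> \<F>} \<le> 2 * p + 1" by linarith
  assume "card {j \<in> {0..<2 * int n}. arc p ws j \<in> \<F>} = 2 * p + 1"
  then have eq: "int (card {j \<in> {0..<2 * int n}. arc p ws j \<in> \<F>}) = 2 * int p + 1" by linarith
  show "\<exists>y\<in>{0..<2 * int n}. \<forall>d\<in>{0..<2 * int n}. arc p ws (y - d) \<in> \<F> \<longleftrightarrow> d < 2 * int p + 1"
    by (rule cyclic_intersecting_block[where Q = "\<lambda>j. arc p ws j \<in> \<F>", OF per K _ eq]) (rule dis)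
qed

text \<open>Around slot \<open>0\<close> the edges are those of \<open>z\<close>, of
  \<open>P\<close> with that of \<open>v\<close> last, of \<open>x\<close>, of \<open>Q\<close>, and
  of \<open>u\<close>: \<open>2 * p + 2\<close> edges, which fit since \<open>n > 2 * p + 1\<close>.
  The starts \<open>0\<close> and \<open>- 2 * int p\<close> give the extreme arcs through
  \<open>x\<close>, the other starts their neighbours.\<close>

lemma exists_arrangement:
  assumes p: "p \<ge> 1" and n: "n > 2 * p + 1"
    and x: "idx x \<in> {1..n}" and P: "P \<subseteq> {1..n} - {idx x}" "card P = p"
    and Q: "Q \<subseteq> {1..n} - {idx x}" "card Q = p - 1" "P \<inter> Q = {}"
    and u: "idx u \<in> {1..n} - {idx x} - P - Q"
    and z: "idx z \<in> {1..n} - {idx x} - P - Q - {idx u}"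
    and v: "idx v \<in> P"
  shows "\<exists>ws\<in>arrangements n.
    arc p ws 0 = insert u (idx -` insert (idx x) Q) \<and>
    arc p ws 1 = insert (mate x) (idx -` insert (idx u) Q) \<and>
    arc p ws (- 1) = insert v (idx -` insert (idx x) Q) \<and>
    arc p ws (- 2 * int p) = insert x (idx -` P) \<and>
    arc p ws (- 2 * int p - 1) = insert z (idx -` P)"
proof -
  define qs where "qs = edge_list Q"
  define ps where "ps = edge_list (P - {idx v})"
  have fin: "finite Q" "finite P" "finite (P - {idx v})" using P Q finite_subset by blast+
  have qs: "length qs = p - 1" "idx ` set qs = Q" "distinct (map idx qs)"
    unfolding qs_def using edge_list[OF fin(1)] Q by auto
  have ps: "length ps = p - 1" "idx ` set ps = P - {idx v}" "distinct (map idx ps)"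
    unfolding ps_def using edge_list[OF fin(3)] P v fin by auto
  \<comment> \<open>\<open>us\<close> occupies the first and \<open>vs\<close> the last
    \<open>p + 1\<close> slots. The vertices \<open>z\<close> and \<open>v\<close> enter as mates
    because an arc with an odd start begins with the mate of the listed vertex.\<close>
  define us where "us = x # qs @ [u]"
  define vs where "vs = mate z # ps @ [mate v]"
  have "distinct (map idx (us @ vs))"
  proof -
    have eq: "map idx (us @ vs) = idx x # map idx qs @ idx u # idx z # map idx ps @ [idx v]"
      by (simp add: us_def vs_def)
    have sets: "set (map idx qs) = Q" "set (map idx ps) = P - {idx v}" using qs(2) ps(2) by simp_all
    have x': "idx x \<notin> P" "idx x \<notin> Q" using P(1) Q(1) by auto
    have u': "idx u \<notin> P" "idx u \<notin> Q" "idx u \<noteq> idx x" using u by simp_all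
    have z': "idx z \<notin> P" "idx z \<notin> Q" "idx z \<noteq> idx x" "idx z \<noteq> idx u" using z by simp_all
    have v': "idx v \<notin> Q" using v Q(3) by auto
    have neq: "idx v \<noteq> idx x" "idx v \<noteq> idx u" "idx v \<noteq> idx z"
      using v x'(1) u'(1) z'(1) by metis+
    have "Q \<inter> P = {}" using Q(3) by auto
    with x' u' z' v' neq show ?thesis
      unfolding eq distinct.simps distinct_append set_append list.set sets using qs(3) ps(3)
      by (simp add: Int_Un_distrib)
  qed
  moreover have "idx ` set (us @ vs) \<subseteq> {1..n}"
  proof -
    have "idx ` set (us @ vs) = {idx x, idx u, idx z, idx v} \<union> Q \<union> (P - {idx v})"
      unfolding us_def vs_def using qs(2) ps(2) by auto
    moreover have "idx u \<in> {1..n}" "idx z \<in> {1..n}" "idx v \<in> {1..n}" using u z v P(1) by auto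
    moreover have "Q \<union> (P - {idx v}) \<subseteq> {1..n}" using P(1) Q(1) by auto
    ultimately show ?thesis using x by (simp del: atLeastAtMost_iff)
  qed
  ultimately obtain ms where ms: "us @ ms @ vs \<in> arrangements n" using arrangement_extend by blast
  define ws where "ws = us @ ms @ vs"
  have ws: "ws \<in> arrangements n" using ms by (simp add: ws_def)
  have n0: "n > 0" using n by simp
  have len: "length ws = n" by (rule arrangementsD(1)[OF ws])
  have lus: "length us = p + 1" "length vs = p + 1" unfolding us_def vs_def using qs(1) ps(1) p by auto
  have lms: "length ms = n - 2 * p - 2" using len lus by (simp add: ws_def)
  have s0: "slot ws 0 = x" using slot_nth[OF ws n0, of 0] n by (simp add: ws_def us_def)
  have sp: "slot ws (int p) = u"
    using slot_nth[OF ws n0, of p] n p qs(1) by (simp add: ws_def us_def nth_append)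
  have slast: "slot ws (- 1) = mate v"
  proof -
    have "slot ws (- 1) = slot ws (int (n - 1))"
      using n len by (simp add: slot_def zmod_minus1)
    also have "\<dots> = ws ! (n - 1)" by (rule slot_nth[OF ws n0]) (use n in simp)
    also have "\<dots> = last ws" using len n by (metis last_conv_nth list.size(3) not_less_zero)
    finally show ?thesis by (simp add: ws_def vs_def)
  qed
  have sz: "slot ws (int (n - p) - 1) = mate z"
  proof -
    have "int (n - p) - 1 = int (n - p - 1)" using n by linarith
    then have "slot ws (int (n - p) - 1) = slot ws (int (n - p - 1))" by (rule arg_cong)
    also have "\<dots> = ws ! (n - p - 1)" by (rule slot_nth[OF ws n0]) (use n in simp)
    also have "n - p - 1 = length (us @ ms)" using lus lms n by simp
    finally show ?thesis by (simp add: ws_def vs_def nth_append)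
  qed
  have b0: "idx ` slot ws ` {0..<int p} = insert (idx x) Q"
  proof -
    have "slot ws ` {0..<int p} = set (take p ws)" using slot_image[OF ws n0, of 0 p] n by simp
    also have "take p ws = x # qs" using p qs(1) by (cases p) (auto simp: ws_def us_def)
    finally show ?thesis using qs(2) by simp
  qed
  have b1: "idx ` slot ws ` {1..<1 + int p} = insert (idx u) Q"
  proof -
    have "slot ws ` {1..<1 + int p} = set (take p (drop 1 ws))"
      using slot_image[OF ws n0, of 1 "p + 1"] n by (simp add: add.commute)
    also have "take p (drop 1 ws) = qs @ [u]" using p qs(1) by (simp add: ws_def us_def)
    finally show ?thesis using qs(2) by auto
  qed
  have bp: "idx ` slot ws ` {int (n - p)..<int n} = P"
  proof -
    have "slot ws ` {int (n - p)..<int n} = set (take p (drop (n - p) ws))"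
      using slot_image[OF ws n0, of "n - p" n] n by (simp del: of_nat_diff)
    also have "drop (n - p) ws = ps @ [mate v]"
    proof -
      have "ws = (us @ ms @ [mate z]) @ ps @ [mate v]" by (simp add: ws_def vs_def)
      moreover have "n - p = length (us @ ms @ [mate z])" using lus lms n by simp
      ultimately show ?thesis by (metis append_eq_conv_conj)
    qed
    also have "take p (ps @ [mate v]) = ps @ [mate v]" using ps(1) p by simp
    finally show ?thesis using ps(2) v by auto
  qed
  have np: "int (n - p) + int p = int n" using n by simp
  have sn: "slot ws (int n) = x" using s0 len by (simp add: slot_def)
  \<comment> \<open>Adding the period moves the negative starts to the listed slots of
    \<open>vs\<close>.\<close>
  have a: "arc p ws (- 2 * int p) = arc p ws (2 * int (n - p))"
  proof -
    have "- 2 * int p + 2 * int n = 2 * int (n - p)" using n by simp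
    then show ?thesis using arc_periodic[OF ws n0, of p "- 2 * int p"] by metis
  qed
  have a': "arc p ws (- 2 * int p - 1) = arc p ws (2 * int (n - p) - 1)"
  proof -
    have "- 2 * int p - 1 + 2 * int n = 2 * int (n - p) - 1" using n by simp
    then show ?thesis using arc_periodic[OF ws n0, of p "- 2 * int p - 1"] by metis
  qed
  show ?thesis
  proof (intro bexI[OF _ ws] conjI)
    show "arc p ws 0 = insert u (idx -` insert (idx x) Q)"
      using arc_even[OF ws n0, of p 0] sp b0 by simp
    show "arc p ws 1 = insert (mate x) (idx -` insert (idx u) Q)"
      using arc_odd[OF ws n0, of p 1] s0 b1 by simp
    show "arc p ws (- 1) = insert v (idx -` insert (idx x) Q)"
      using arc_odd[OF ws n0, of p 0] slast b0 by simp
    show "arc p ws (- 2 * int p) = insert x (idx -` P)"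
      unfolding a arc_even[OF ws n0] np sn bp ..
    show "arc p ws (- 2 * int p - 1) = insert z (idx -` P)"
      unfolding a' arc_odd[OF ws n0] np sz bp by simp
  qed
qed

section \<open>Uniqueness of the centre\<close>

text \<open>Maximality enters the local argument only through \<open>full\<close>: the bound is
  attained on every cycle, not merely on average.\<close>

locale full_arcs =
  fixes p n :: nat and \<F> :: "vertex set set"
  assumes p: "p \<ge> 1" and n: "n > 2 * p + 1"
    and intersecting: "intersecting \<F>"
    and full: "ws \<in> arrangements n \<Longrightarrow> card {j \<in> {0..<2 * int n}. arc p ws j \<in> \<F>} = 2 * p + 1"
begin

lemma n0: "n > 0"
  using n by simp

text \<open>The hypothesis fixes the block of members as the starts from \<open>- 2 * int p\<close>
  to \<open>0\<close>, and all memberships are then read off.\<close>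

lemma arc_centre:
  assumes ws: "ws \<in> arrangements n"
    and "arc p ws 0 \<in> \<F> \<and> arc p ws (- 2 * int p) \<in> \<F> \<or>
      arc p ws 0 \<in> \<F> \<and> arc p ws 1 \<notin> \<F> \<or>
      arc p ws (- 2 * int p) \<in> \<F> \<and> arc p ws (- 2 * int p - 1) \<notin> \<F>"
  shows "arc p ws 0 \<in> \<F>" "arc p ws (- 2 * int p) \<in> \<F>" "arc p ws (- 1) \<in> \<F>"
    "arc p ws 1 \<notin> \<F>" "arc p ws (- 2 * int p - 1) \<notin> \<F>"
proof -
  have per: "arc p ws (i + 2 * int n) \<in> \<F> \<longleftrightarrow> arc p ws i \<in> \<F>" for i
    using arc_periodic[OF ws n0] by simp
  have K: "1 \<le> 2 * int p + 1" "2 * (2 * int p + 1) < 2 * int n" using n by auto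
  obtain y where y: "y \<in> {0..<2 * int n}"
    "\<forall>d\<in>{0..<2 * int n}. arc p ws (y - d) \<in> \<F> \<longleftrightarrow> d < 2 * int p + 1"
    using card_arcs_intersecting(2)[OF ws n intersecting full[OF ws]] by (elim bexE)
  have "y = 0"
  proof (rule cyclic_block_centre[where Q = "\<lambda>j. arc p ws j \<in> \<F>", OF per K y(1)])
    show "arc p ws (y - d) \<in> \<F> \<longleftrightarrow> d < 2 * int p + 1" if "d \<in> {0..<2 * int n}" for d
      using y(2) that by (rule bspec)
    have "1 - (2 * int p + 1) = - 2 * int p" "- (2 * int p + 1) = - 2 * int p - 1" by simp_all
    then show "arc p ws 0 \<in> \<F> \<and> arc p ws (1 - (2 * int p + 1)) \<in> \<F> \<or>
        arc p ws 0 \<in> \<F> \<and> arc p ws 1 \<notin> \<F> \<or>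
        arc p ws (1 - (2 * int p + 1)) \<in> \<F> \<and> arc p ws (- (2 * int p + 1)) \<notin> \<F>"
      using assms(2) by (simp only:)
  qed
  then have block: "arc p ws (- d) \<in> \<F> \<longleftrightarrow> d < 2 * int p + 1" if "0 \<le> d" "d < 2 * int n" for d
    using y(2) that by simp
  show "arc p ws 0 \<in> \<F>" "arc p ws (- 2 * int p) \<in> \<F>" "arc p ws (- 1) \<in> \<F>"
    using block[of 0] block[of "2 * int p"] block[of 1] p n by simp_all
  \<comment> \<open>Modulo the period, the start \<open>1\<close> lies \<open>2 * int n - 1\<close>
    steps before \<open>0\<close>, outside the block.\<close>
  show "arc p ws 1 \<notin> \<F>" using block[of "2 * int n - 1"] per[of "1 - 2 * int n"] n by simp
  show "arc p ws (- 2 * int p - 1) \<notin> \<F>" using block[of "2 * int p + 1"] n by simp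
qed

text \<open>The arcs next to a centre \<open>x\<close>: \<open>half_with x P\<close> and \<open>edge_with x Q u\<close> are the two extreme arcs
  through \<open>x\<close>, which meet in \<open>x\<close> only; \<open>insert z (idx -` P)\<close> and \<open>mate_with x Q u\<close> are the arcs
  just beyond them.\<close>

definition other_edges :: "vertex \<Rightarrow> nat set" where
  "other_edges x = {1..n} - {idx x}"

abbreviation half_with :: "vertex \<Rightarrow> nat set \<Rightarrow> vertex set" where
  "half_with x P \<equiv> insert x (idx -` P)"

abbreviation edge_with :: "vertex \<Rightarrow> nat set \<Rightarrow> vertex \<Rightarrow> vertex set" where
  "edge_with x Q u \<equiv> insert u (idx -` insert (idx x) Q)"

abbreviation mate_with :: "vertex \<Rightarrow> nat set \<Rightarrow> vertex \<Rightarrow> vertex set" where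
  "mate_with x Q u \<equiv> insert (mate x) (idx -` insert (idx u) Q)"

text \<open>Certifies \<open>x\<close> as a centre by its two extreme arcs. With the edge of
  \<open>x\<close> the data occupy \<open>2 * p + 1\<close> of the \<open>n\<close> edges, which
  leaves an edge for a vertex \<open>z\<close> beyond \<open>P\<close>.\<close>

definition good :: "vertex \<Rightarrow> nat set \<Rightarrow> nat set \<Rightarrow> vertex \<Rightarrow> bool" where
  "good x P Q u \<longleftrightarrow>
     P \<subseteq> other_edges x \<and> card P = p \<and> Q \<subseteq> other_edges x \<and> card Q = p - 1 \<and> P \<inter> Q = {} \<and>
     idx u \<in> other_edges x - P - Q \<and> half_with x P \<in> \<F> \<and> edge_with x Q u \<in> \<F>"

lemma goodD:
  assumes "good x P Q u"
  shows "P \<subseteq> other_edges x" "card P = p" "Q \<subseteq> other_edges x" "card Q = p - 1" "P \<inter> Q = {}"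
    "idx u \<in> other_edges x - P - Q" "half_with x P \<in> \<F>" "edge_with x Q u \<in> \<F>"
  using assms unfolding good_def by simp_all

lemma goodI:
  assumes "P \<subseteq> other_edges x" "card P = p" "Q \<subseteq> other_edges x" "card Q = p - 1" "P \<inter> Q = {}"
    "idx u \<in> other_edges x - P - Q" "half_with x P \<in> \<F>" "edge_with x Q u \<in> \<F>"
  shows "good x P Q u"
  using assms unfolding good_def by simp

lemma finite_other_edges: "finite (other_edges x)"
  by (simp add: other_edges_def)

text \<open>Every cycle has a block of members; a symmetry moves its last start to position
  \<open>0\<close>, and the vertex there serves as \<open>x\<close>.\<close>

lemma good_exists: "\<exists>x P Q u. idx x \<in> {1..n} \<and> good x P Q u"
proof -
  obtain ws0 where ws0: "ws0 \<in> arrangements n"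
    using arrangement_extend[of "[]" "[]" n] by auto
  obtain y where y: "y \<in> {0..<2 * int n}"
    "\<forall>d\<in>{0..<2 * int n}. arc p ws0 (y - d) \<in> \<F> \<longleftrightarrow> d < 2 * int p + 1"
    using card_arcs_intersecting(2)[OF ws0 n intersecting full[OF ws0]] by (elim bexE)
  have y0: "arc p ws0 y \<in> \<F>" "arc p ws0 (y - 2 * int p) \<in> \<F>"
    using y(2)[rule_format, of 0] y(2)[rule_format, of "2 * int p"] n by simp_all
  obtain ws where ws: "ws \<in> arrangements n" "arc p ws 0 \<in> \<F>" "arc p ws (- 2 * int p) \<in> \<F>"
  proof (cases "even y")
    case True
    then obtain m where m: "y = 2 * m" by blast
    obtain ws where "ws \<in> arrangements n" "\<forall>j. arc p ws j = arc p ws0 (j + 2 * m)"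
      using rotate_arrangement[OF ws0 n0] by blast
    then show ?thesis using that y0 m by (simp add: add.commute)
  next
    case False
    \<comment> \<open>Rotations preserve the parity of \<open>y\<close>. Reflection and rotation
      together send the starts \<open>y - 2 * int p\<close> and \<open>y\<close> to \<open>0\<close>
      and \<open>- 2 * int p\<close>.\<close>
    obtain ws1 where ws1: "ws1 \<in> arrangements n" "\<forall>j. arc p ws1 j = arc p ws0 (- 1 - j - 2 * int p)"
      using reflect_arrangement[OF ws0 n0] by blast
    have "even (- 1 - y)" using False by simp
    then obtain m where m: "- 1 - y = 2 * m" by blast
    obtain ws where "ws \<in> arrangements n" "\<forall>j. arc p ws j = arc p ws1 (j + 2 * m)"
      using rotate_arrangement[OF ws1(1) n0] by blast
    then show ?thesis using that y0 ws1(2) by (simp add: m[symmetric])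
  qed
  define f where "f = (\<lambda>i. idx (slot ws i))"
  have f: "f i \<noteq> f j" if "i < j" "j \<le> i + 2 * int p" for i j
    unfolding f_def using idx_slot_neq[OF ws(1) n0 that(1)] that(2) n by simp
  have f': "f i \<noteq> f j" if "i \<noteq> j" "i \<in> {- int p..int p}" "j \<in> {- int p..int p}" for i j
    using f[of i j] f[of j i] that by (cases "i < j") auto
  have fin: "f i \<in> {1..n}" for i unfolding f_def by (rule idx_slot_in[OF ws(1) n0])
  define P where "P = f ` {- int p..<0}"
  define Q where "Q = f ` {1..<int p}"
  have cP: "card P = p"
    using slot_block(1)[OF ws(1) n0, of p "- int p"] n by (simp add: P_def f_def image_image)
  have cQ: "card Q = p - 1"
    using slot_block(1)[OF ws(1) n0, of "p - 1" 1] n p by (simp add: Q_def f_def image_image of_nat_diff)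
  have sub: "P \<subseteq> {1..n} - {f 0}" "Q \<subseteq> {1..n} - {f 0}"
    unfolding P_def Q_def using fin f' by fastforce+
  have dis: "P \<inter> Q = {}" unfolding P_def Q_def using f' by fastforce
  have "f (int p) \<noteq> f 0" using f'[of "int p" 0] p by simp
  moreover have "f (int p) \<notin> P"
  proof
    assume "f (int p) \<in> P"
    then obtain j where "- int p \<le> j" "j < 0" "f (int p) = f j" by (auto simp: P_def)
    then show False using f'[of "int p" j] by simp
  qed
  moreover have "f (int p) \<notin> Q"
  proof
    assume "f (int p) \<in> Q"
    then obtain j where "1 \<le> j" "j < int p" "f (int p) = f j" by (auto simp: Q_def)
    then show False using f'[of "int p" j] by simp
  qed
  ultimately have u: "f (int p) \<in> {1..n} - {f 0} - P - Q" using fin by simp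
  have "arc p ws (- 2 * int p) = insert (slot ws 0) (idx -` P)"
    using arc_even[OF ws(1) n0, of p "- int p"] by (simp add: P_def f_def image_image)
  moreover have "{0..<int p} = insert 0 {1..<int p}" using p by auto
  then have "arc p ws 0 = insert (slot ws (int p)) (idx -` insert (f 0) Q)"
    using arc_even[OF ws(1) n0, of p 0] by (simp add: Q_def f_def image_image)
  ultimately have "good (slot ws 0) P Q (slot ws (int p))"
    unfolding good_def other_edges_def using ws cP cQ sub dis u by (simp add: f_def)
  moreover have "idx (slot ws 0) \<in> {1..n}" using fin by (simp add: f_def)
  ultimately show ?thesis by blast
qed

section \<open>Exchange steps around a fixed centre\<close>

context
  fixes x :: vertex
  assumes x: "idx x \<in> {1..n}"
begin

text \<open>Two of the four arcs at the ends of the block determine its position, so membership in \<open>\<F>\<close>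
  passes from one known pair of arcs to all the others.\<close>

lemma local_centre:
  assumes "P \<subseteq> other_edges x" "card P = p" "Q \<subseteq> other_edges x" "card Q = p - 1" "P \<inter> Q = {}"
    and "idx u \<in> other_edges x - P - Q" "idx z \<in> other_edges x - P - Q - {idx u}" "idx v \<in> P"
    and "half_with x P \<in> \<F> \<and> edge_with x Q u \<in> \<F> \<or> edge_with x Q u \<in> \<F> \<and> mate_with x Q u \<notin> \<F> \<or>
      half_with x P \<in> \<F> \<and> insert z (idx -` P) \<notin> \<F>"
  shows "half_with x P \<in> \<F>" "edge_with x Q u \<in> \<F>" "edge_with x Q v \<in> \<F>" "mate_with x Q u \<notin> \<F>" "insert z (idx -` P) \<notin> \<F>"
proof -
  obtain ws where ws: "ws \<in> arrangements n" "arc p ws 0 = edge_with x Q u" "arc p ws 1 = mate_with x Q u"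
    "arc p ws (- 1) = edge_with x Q v" "arc p ws (- 2 * int p) = half_with x P"
    "arc p ws (- 2 * int p - 1) = insert z (idx -` P)"
    using exists_arrangement[OF p n x assms(1-8)[unfolded other_edges_def]] by (elim bexE conjE)
  have "edge_with x Q u \<in> \<F> \<and> half_with x P \<in> \<F> \<or> edge_with x Q u \<in> \<F> \<and> mate_with x Q u \<notin> \<F> \<or>
      half_with x P \<in> \<F> \<and> insert z (idx -` P) \<notin> \<F>"
    using assms(9) by argo
  note * = arc_centre[OF ws(1), unfolded ws(2-6), OF this]
  show "half_with x P \<in> \<F>" "edge_with x Q u \<in> \<F>" "edge_with x Q v \<in> \<F>" "mate_with x Q u \<notin> \<F>" "insert z (idx -` P) \<notin> \<F>"
    by (fact *)+
qed

lemma card_other_edges: "card (other_edges x) = n - 1"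
  using x by (simp add: other_edges_def)

lemma pick:
  assumes "S \<subseteq> other_edges x - T" "T \<subseteq> other_edges x" "card S \<le> k" "k + card T < n"
  obtains P where "S \<subseteq> P" "P \<subseteq> other_edges x - T" "card P = k"
proof -
  have "finite T" using finite_subset[OF assms(2) finite_other_edges] .
  then have "card (other_edges x - T) = n - 1 - card T" using assms(2) card_other_edges by (simp add: card_Diff_subset)
  then have "k \<le> card (other_edges x - T)" using assms(4) by simp
  from exists_subset_between[OF assms(3) this assms(1) finite_Diff[OF finite_other_edges]] show thesis
    by (elim exE conjE) (rule that)
qed

lemma pick_vertex:
  assumes "T \<subseteq> other_edges x" "card T + 1 < n"
  obtains z where "idx z \<in> other_edges x - T"
proof -
  obtain P where "P \<subseteq> other_edges x - T" "card P = 1" using pick[of "{}" T 1] assms by auto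
  then obtain i where "i \<in> other_edges x - T" by (auto simp: card_1_singleton_iff)
  then show thesis using that[of "L i"] by simp
qed

lemma pick_element:
  assumes "card P = p" obtains v where "idx v \<in> P"
proof -
  obtain i where "i \<in> P" using assms p by (cases "P = {}") auto
  then show thesis using that[of "L i"] by simp
qed

text \<open>A free edge completes the data to a cycle whose block is known. Each of the two
  non-members involves one side only: the first allows \<open>P\<close> to be exchanged, the second
  \<open>Q\<close> and \<open>u\<close>.\<close>

lemma good_boundary:
  assumes "good x P Q u"
  shows "mate_with x Q u \<notin> \<F>"
    and "\<lbrakk>idx z \<in> other_edges x - P - Q - {idx u}\<rbrakk> \<Longrightarrow> insert z (idx -` P) \<notin> \<F>"
proof -
  note g = goodD[OF assms]
  have fin: "finite P" "finite Q" using g(1,3) finite_other_edges finite_subset by blast+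
  obtain v where v: "idx v \<in> P" using pick_element[OF g(2)] .
  have "card (insert (idx u) (P \<union> Q)) + 1 < n"
    using g(2,4,5,6) fin p n by (simp add: card_Un_disjoint)
  moreover have "insert (idx u) (P \<union> Q) \<subseteq> other_edges x" using g(1,3,6) by blast
  ultimately obtain z0 where "idx z0 \<in> other_edges x - insert (idx u) (P \<union> Q)" using pick_vertex by blast
  then have z0: "idx z0 \<in> other_edges x - P - Q - {idx u}" by blast
  show "mate_with x Q u \<notin> \<F>"
    by (rule local_centre(4)[OF g(1-6) z0 v]) (use g(7,8) in simp)
  show "insert z (idx -` P) \<notin> \<F>" if "idx z \<in> other_edges x - P - Q - {idx u}"
    by (rule local_centre(5)[OF g(1-6) that v]) (use g(7,8) in simp)
qed

text \<open>The end of the block on the side of \<open>Q\<close> alone fixes the centre, whatever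
  admissible \<open>P\<close> stands on the other side. The arc one step back replaces
  \<open>u\<close> by a vertex \<open>v\<close> on an edge of \<open>P\<close>.\<close>

lemma boundary_imp_good:
  assumes "edge_with x Q u \<in> \<F>" "mate_with x Q u \<notin> \<F>" "Q \<subseteq> other_edges x" "card Q = p - 1" "idx u \<in> other_edges x - Q"
    and "P \<subseteq> other_edges x - Q - {idx u}" "card P = p"
  shows "good x P Q u" and "\<And>v. idx v \<in> P \<Longrightarrow> edge_with x Q v \<in> \<F>"
proof -
  have PX: "P \<subseteq> other_edges x" using assms(6) by blast
  have fin: "finite P" "finite Q" using PX assms(3) finite_other_edges finite_subset by blast+
  have dis: "P \<inter> Q = {}" "idx u \<notin> P \<union> Q" using assms(5,6) by blast+
  have "card (insert (idx u) (P \<union> Q)) + 1 < n"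
    using assms(4,7) fin p n dis by (simp add: card_Un_disjoint)
  moreover have "insert (idx u) (P \<union> Q) \<subseteq> other_edges x" using PX assms(3,5) by blast
  ultimately obtain z where "idx z \<in> other_edges x - insert (idx u) (P \<union> Q)" using pick_vertex by blast
  then have z: "idx z \<in> other_edges x - P - Q - {idx u}" by blast
  have u: "idx u \<in> other_edges x - P - Q" using assms(5) dis(2) by blast
  have disj: "half_with x P \<in> \<F> \<and> edge_with x Q u \<in> \<F> \<or> edge_with x Q u \<in> \<F> \<and> mate_with x Q u \<notin> \<F> \<or>
      half_with x P \<in> \<F> \<and> insert z (idx -` P) \<notin> \<F>"
    using assms(1,2) by simp
  note lc = local_centre[OF PX assms(7) assms(3,4) dis(1) u z _ disj]
  show "\<And>v. idx v \<in> P \<Longrightarrow> edge_with x Q v \<in> \<F>" by (rule lc(3))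
  obtain v where "idx v \<in> P" using pick_element[OF assms(7)] by blast
  then have "half_with x P \<in> \<F>" by (rule lc(1))
  then show "good x P Q u"
    by (intro goodI) (rule PX assms(7,3,4,1) dis(1) u | assumption)+
qed

text \<open>Two choices of \<open>P\<close>: one containing the edge of \<open>v\<close> makes
  \<open>edge_with x Q v\<close> a member, another avoiding it supplies the opposite extreme
  arc.\<close>

lemma good_other_u:
  assumes "good x P Q u" "idx v \<in> other_edges x - Q - {idx u}"
  shows "\<exists>P'. good x P' Q v"
proof -
  note g = goodD[OF assms(1)]
  have fin: "finite Q" using g(3) finite_other_edges finite_subset by blast
  have u: "idx u \<in> other_edges x - Q" using g(6) by blast
  note B = g(8,3,4)
  note B' = good_boundary(1)[OF assms(1)]
  have "card (insert (idx u) Q) + p < n" using B(3) fin u p n by simp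
  moreover have "insert (idx u) Q \<subseteq> other_edges x" using u B(2) by blast
  moreover have "{idx v} \<subseteq> other_edges x - insert (idx u) Q" using assms(2) by simp
  ultimately obtain P1 where P1: "{idx v} \<subseteq> P1" "P1 \<subseteq> other_edges x - insert (idx u) Q" "card P1 = p"
    using pick[of "{idx v}" "insert (idx u) Q" p] p by (auto simp: add.commute)
  have P1': "P1 \<subseteq> other_edges x - Q - {idx u}" "idx v \<in> P1" using P1 by blast+
  have v: "edge_with x Q v \<in> \<F>" by (rule boundary_imp_good(2)[OF B(1) B' B(2,3) u P1'(1) P1(3) P1'(2)])
  have ne: "idx v \<noteq> idx u" "idx v \<notin> Q" using assms(2) by blast+
  have "card (insert (idx v) (insert (idx u) Q)) + p < n" using B(3) fin u ne p n by simp
  moreover have "insert (idx v) (insert (idx u) Q) \<subseteq> other_edges x" using u B(2) assms(2) by blast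
  ultimately obtain P2 where P2: "P2 \<subseteq> other_edges x - insert (idx v) (insert (idx u) Q)" "card P2 = p"
    using pick[of "{}" "insert (idx v) (insert (idx u) Q)" p] by (auto simp: add.commute)
  have "P2 \<subseteq> other_edges x - Q - {idx u}" using P2 by blast
  then have "good x P2 Q u" by (rule boundary_imp_good(1)[OF B(1) B' B(2,3) u _ P2(2)])
  note g2 = goodD[OF this]
  have "idx v \<in> other_edges x - P2 - Q" using assms(2) P2(1) by blast
  then have "good x P2 Q v" by (rule goodI[OF g2(1-5) _ g2(7) v])
  then show ?thesis ..
qed

text \<open>Only the endpoints of the edge of \<open>u\<close> remain; a detour over a third edge
  reaches them.\<close>

lemma good_all_u:
  assumes "good x P Q u" "idx v \<in> other_edges x - Q"
  shows "\<exists>P'. good x P' Q v"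
proof (cases "idx v = idx u")
  case True
  note g = goodD[OF assms(1)]
  have "finite Q" using g(3) finite_other_edges finite_subset by blast
  then have "card (insert (idx u) Q) + 1 < n" using g(4,6) p n by simp
  moreover have "insert (idx u) Q \<subseteq> other_edges x" using g(3,6) by blast
  ultimately obtain w where w: "idx w \<in> other_edges x - insert (idx u) Q" using pick_vertex by blast
  then obtain P' where "good x P' Q w" using good_other_u[OF assms(1), of w] by blast
  then show ?thesis using w True assms(2) by (intro good_other_u) auto
next
  case False
  then show ?thesis using good_other_u[OF assms(1)] assms(2) by blast
qed

text \<open>\<open>P'\<close> may contain the edge of \<open>u\<close>, so \<open>u\<close> is first
  moved to an edge outside \<open>P'\<close> and \<open>Q\<close>.\<close>

lemma good_all_P:
  assumes "good x P Q u" "P' \<subseteq> other_edges x - Q" "card P' = p"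
  shows "half_with x P' \<in> \<F>"
proof -
  note g = goodD[OF assms(1)]
  have P': "P' \<subseteq> other_edges x" using assms(2) by blast
  have fin: "finite P'" "finite Q" using g(3) P' finite_other_edges finite_subset by blast+
  have "P' \<inter> Q = {}" using assms(2) by blast
  then have "card (P' \<union> Q) + 1 < n" using g(4) fin assms(3) p n by (simp add: card_Un_disjoint)
  moreover have "P' \<union> Q \<subseteq> other_edges x" using g(3) P' by blast
  ultimately obtain w where w: "idx w \<in> other_edges x - (P' \<union> Q)" using pick_vertex by blast
  then obtain P1 where P1: "good x P1 Q w" using good_all_u[OF assms(1), of w] by blast
  have w': "idx w \<in> other_edges x - Q" "P' \<subseteq> other_edges x - Q - {idx w}" using w assms(2) by blast+
  show ?thesis
    by (rule goodD(7)[OF boundary_imp_good(1)[OF goodD(8)[OF P1] good_boundary(1)[OF P1] g(3,4) w' assms(3)]])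
qed

text \<open>Now the side of \<open>P\<close> is held fixed. With \<open>u\<close> moved to the edge
  \<open>r\<close>, the arc beyond \<open>P1\<close> is seen to be no member, and this still fixes
  the centre after \<open>q\<close> and \<open>r\<close> have changed roles.\<close>

lemma good_exchange:
  assumes "good x P Q u" "q \<in> Q" "r \<in> other_edges x - Q"
  shows "\<exists>P' u'. good x P' (insert r (Q - {q})) u'"
proof -
  note g = goodD[OF assms(1)]
  let ?Q' = "insert r (Q - {q})"
  have fin: "finite Q" using g(3) finite_other_edges finite_subset by blast
  have "card (insert r Q) + p < n" using g(4) assms(3) fin p n by simp
  moreover have "insert r Q \<subseteq> other_edges x" using g(3) assms(3) by blast
  ultimately obtain P1 where P1: "P1 \<subseteq> other_edges x - insert r Q" "card P1 = p"
    using pick[of "{}" "insert r Q" p] by (auto simp: add.commute)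
  have P1': "P1 \<subseteq> other_edges x - Q" "P1 \<subseteq> other_edges x" using P1(1) by blast+
  have fin1: "finite P1" using P1'(2) finite_other_edges finite_subset by blast
  have "P1 \<inter> insert r Q = {}" using P1(1) by blast
  then have "card (P1 \<union> insert r Q) + 1 < n"
    using P1(2) g(4) assms(3) fin fin1 p n by (simp add: card_Un_disjoint)
  moreover have "P1 \<union> insert r Q \<subseteq> other_edges x" using P1'(2) g(3) assms(3) by blast
  ultimately obtain z where z: "idx z \<in> other_edges x - (P1 \<union> insert r Q)" using pick_vertex by blast
  have A: "half_with x P1 \<in> \<F>" by (rule good_all_P[OF assms(1) P1'(1) P1(2)])
  obtain P2 where P2: "good x P2 Q (L r)" using good_all_u[OF assms(1), of "L r"] assms(3) by auto
  have "P1 \<inter> Q = {}" "idx (L r) \<in> other_edges x - P1 - Q" using P1(1) assms(3) by auto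
  then have "good x P1 Q (L r)"
    by (intro goodI[OF P1'(2) P1(2) g(3,4) _ _ A goodD(8)[OF P2]])
  then have A': "insert z (idx -` P1) \<notin> \<F>"
    by (rule good_boundary(2)) (use z in auto)
  have "card Q > 0" using assms(2) fin card_gt_0_iff by blast
  then have cQ': "card ?Q' = p - 1" using g(4) assms(2,3) fin by simp
  obtain v where v: "idx v \<in> P1" using pick_element[OF P1(2)] by blast
  have side: "P1 \<subseteq> other_edges x" "?Q' \<subseteq> other_edges x" "P1 \<inter> ?Q' = {}" "idx (L q) \<in> other_edges x - P1 - ?Q'"
    "idx z \<in> other_edges x - P1 - ?Q' - {idx (L q)}"
    using P1(1) g(3) assms(2,3) z by auto
  \<comment> \<open>\<open>L q\<close> takes the place of \<open>u\<close>; \<open>A\<close> and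
    \<open>A'\<close> fix the block and involve neither \<open>Q\<close> nor
    \<open>?Q'\<close>.\<close>
  have "edge_with x ?Q' (L q) \<in> \<F>"
    by (rule local_centre(2)[OF side(1) P1(2) side(2) cQ' side(3,4,5) v]) (use A A' in simp)
  then have "good x P1 ?Q' (L q)" by (rule goodI[OF side(1) P1(2) side(2) cQ' side(3,4) A])
  then show ?thesis by blast
qed

text \<open>Each exchange trades an element of \<open>Q - Q'\<close> for one of
  \<open>Q' - Q\<close>, so the number of missing elements drops.\<close>

lemma good_all_Q:
  assumes "good x P Q u" "Q' \<subseteq> other_edges x" "card Q' = p - 1"
  shows "\<exists>P' u'. good x P' Q' u'"
  using assms
proof (induction "card (Q' - Q)" arbitrary: P Q u)
  case 0
  note g = goodD[OF 0(2)]
  have fin: "finite Q" "finite Q'" using g(3) 0(3) finite_other_edges finite_subset by blast+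
  have "Q' \<subseteq> Q" using 0(1) fin by simp
  then have "Q' = Q" using card_subset_eq[OF fin(1)] g(4) 0(4) by simp
  then show ?case using 0 by blast
next
  case (Suc k)
  note g = goodD[OF Suc.prems(1)]
  have fin: "finite Q" "finite Q'" using g(3) Suc.prems(2) finite_other_edges finite_subset by blast+
  obtain r where r: "r \<in> Q'" "r \<notin> Q" using Suc.hyps(2) by (metis Diff_iff card.empty all_not_in_conv nat.distinct(1))
  have "\<not> Q \<subseteq> Q'" using card_subset_eq[OF fin(2), of Q] g(4) Suc.prems(3) r by auto
  then obtain q where q: "q \<in> Q" "q \<notin> Q'" by blast
  obtain P' u' where g': "good x P' (insert r (Q - {q})) u'"
    using good_exchange[OF Suc.prems(1) q(1), of r] r Suc.prems(2) by blast
  have "Q' - insert r (Q - {q}) = (Q' - Q) - {r}" using q by blast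
  then have "k = card (Q' - insert r (Q - {q}))" using Suc.hyps(2) r fin by simp
  then show ?case using Suc.hyps(1) g' Suc.prems(2,3) by blast
qed

text \<open>A member through \<open>x\<close> either contains the whole edge of \<open>x\<close>,
  and is an \<open>edge_with\<close>, or has \<open>x\<close> as its half edge, and is a
  \<open>half_with\<close>. Exchanges reach both kinds.\<close>

lemma star_subset:
  assumes "good x P Q u"
  shows "star (matching_family p 1 n) x \<subseteq> \<F>"
proof
  fix H assume "H \<in> star (matching_family p 1 n) x"
  then obtain P' v where H: "P' \<subseteq> {1..n}" "card P' = p" "idx v \<in> {1..n} - P'" "H = insert v (idx -` P')"
    and xH: "x \<in> H"
    unfolding star_def matching_family_1_iff by blast
  have fin: "finite P'" using H(1) finite_subset by blast
  show "H \<in> \<F>"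
  proof (cases "idx x \<in> P'")
    case True
    define Q' where "Q' = P' - {idx x}"
    have Q': "Q' \<subseteq> other_edges x" "card Q' = p - 1" "P' = insert (idx x) Q'" "idx v \<in> other_edges x - Q'"
      unfolding Q'_def other_edges_def using H True fin by auto
    then obtain P1 u1 where "good x P1 Q' u1" using good_all_Q[OF assms] by blast
    then obtain P2 where "good x P2 Q' v" using good_all_u Q'(4) by blast
    then show ?thesis unfolding H(4) Q'(3) by (rule goodD(8))
  next
    case False
    then have v: "x = v" using xH H(4) by auto
    have P': "P' \<subseteq> other_edges x" using H(1) False by (auto simp: other_edges_def)
    have "p - 1 + card P' < n" using H(2) n by simp
    then obtain Q' where Q': "Q' \<subseteq> other_edges x - P'" "card Q' = p - 1"
      using pick[of "{}" P' "p - 1"] P' by auto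
    have Q'': "Q' \<subseteq> other_edges x" "P' \<subseteq> other_edges x - Q'" using Q'(1) P' by blast+
    obtain P1 u1 where "good x P1 Q' u1" using good_all_Q[OF assms Q''(1) Q'(2)] by blast
    then have "half_with x P' \<in> \<F>" by (rule good_all_P[OF _ Q''(2) H(2)])
    then show ?thesis using H(4) v by simp
  qed
qed

end

end

text \<open>Averaging shows that a maximum family is as large as a star and attains the bound on
  every cycle. The exchange argument puts a whole star inside it, and equal sizes finish the
  proof.\<close>

lemma strongly_EKR_matching_family_1:
  assumes p: "p \<ge> 1" and n: "n > 2 * p + 1"
  shows "strongly_EKR (M_verts n) (matching_family p 1 n)"
  unfolding strongly_EKR_def
proof (intro allI impI)
  fix \<F> assume F: "maximum_intersecting (matching_family p 1 n) \<F>"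
  let ?G = "matching_family p 1 n"
  have n0: "n > 0" using n by simp
  have sub: "\<F> \<subseteq> ?G" and int: "intersecting \<F>" using F by (auto simp: maximum_intersecting_def)
  have le: "card (star ?G x) \<le> card \<F>" for x
    using F star_intersecting[of ?G x] by (auto simp: maximum_intersecting_def star_def)
  obtain c where c: "\<forall>\<F> \<subseteq> ?G.
      (\<Sum>ws\<in>arrangements n. card {j \<in> {0..<2 * int n}. arc p ws j \<in> \<F>}) = card \<F> * c"
    using sum_card_arcs[OF n0] by blast
  have star_sum: "card (star ?G x) * c = card (arrangements n) * (2 * p + 1)" if "x \<in> M_verts n" for x
  proof -
    have "card (star ?G x) * c = (\<Sum>ws\<in>arrangements n. card {j \<in> {0..<2 * int n}. arc p ws j \<in> star ?G x})"
      using c[rule_format, of "star ?G x"] by (simp add: star_def)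
    also have "\<dots> = (\<Sum>ws\<in>arrangements n. 2 * p + 1)"
      using card_arcs_star n that by (intro sum.cong) auto
    finally show ?thesis by simp
  qed
  have F_sum: "(\<Sum>ws\<in>arrangements n. card {j \<in> {0..<2 * int n}. arc p ws j \<in> \<F>}) = card \<F> * c"
    using c sub by blast
  have up: "card {j \<in> {0..<2 * int n}. arc p ws j \<in> \<F>} \<le> 2 * p + 1" if "ws \<in> arrangements n" for ws
    by (rule card_arcs_intersecting(1)[OF that n int])
  have "card \<F> * c \<le> (\<Sum>ws\<in>arrangements n. 2 * p + 1)"
    unfolding F_sum[symmetric] by (rule sum_mono) (rule up)
  then have F_le: "card \<F> * c \<le> card (arrangements n) * (2 * p + 1)" by simp
  have L1: "L 1 \<in> M_verts n" using n by simp
  \<comment> \<open>By maximality \<open>\<F>\<close> is at least as large as the star at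
    \<open>L 1\<close>, whose sum already equals the upper bound.\<close>
  have F_eq: "card \<F> * c = card (arrangements n) * (2 * p + 1)"
    using F_le star_sum[OF L1] mult_le_mono1[OF le[of "L 1"], of c] by linarith
  interpret full_arcs p n \<F>
  proof
    show "card {j \<in> {0..<2 * int n}. arc p ws j \<in> \<F>} = 2 * p + 1" if ws: "ws \<in> arrangements n" for ws
    \<comment> \<open>Equal sums together with the termwise bound \<open>up\<close> force equality
      in every term.\<close>
    proof (rule sum_mono_inv[where f = "\<lambda>ws. card {j \<in> {0..<2 * int n}. arc p ws j \<in> \<F>}"
          and g = "\<lambda>_. 2 * p + 1", OF _ up ws finite_arrangements])
      show "(\<Sum>ws\<in>arrangements n. card {j \<in> {0..<2 * int n}. arc p ws j \<in> \<F>}) =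
          (\<Sum>ws\<in>arrangements n. 2 * p + 1)"
        using F_sum F_eq by simp
    qed
  qed (use p n int in simp_all)
  obtain x P Q u where x: "idx x \<in> {1..n}" "good x P Q u" using good_exists by blast
  have xV: "x \<in> M_verts n" using x(1) by simp
  have "arrangements n \<noteq> {}" using arrangement_extend[of "[]" "[]" n] by auto
  then have "card (arrangements n) > 0" using finite_arrangements by (simp add: card_gt_0_iff)
  \<comment> \<open>For \<open>c = 0\<close> the left side of \<open>F_eq\<close> would vanish while
    the right side is positive; so \<open>c\<close> may be cancelled.\<close>
  then have "c > 0" using F_eq by (cases c) auto
  then have "card \<F> \<le> card (star ?G x)" using F_eq star_sum[OF xV] by (metis eq_imp_le mult_le_cancel2)
  moreover have "finite \<F>" using sub finite_matching_family finite_subset by blast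
  ultimately have "star ?G x = \<F>" using star_subset[OF x] by (intro card_seteq)
  then show "\<exists>x\<in>M_verts n. \<F> = star ?G x" using xV by blast
qed

theorem theorem3:
  fixes p s :: nat
  assumes "s \<ge> 1" and "p \<ge> 1"
  shows "(EKR (M_verts (2 * p + s)) (matching_family p s (2 * p + s)) \<and>
          \<not> strongly_EKR (M_verts (2 * p + s)) (matching_family p s (2 * p + s))) \<and>
         (s = 1 \<longrightarrow> (\<forall>n::nat. n > 2 * p + 1 \<longrightarrow> strongly_EKR (M_verts n) (matching_family p s n)))"
  using EKR_matching_family_minimal[OF assms(1)]
    not_strongly_EKR_matching_family_minimal[OF assms] strongly_EKR_matching_family_1[OF assms(2)]
  by blast

end
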